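(* Let $\mathcal{H}$ be a $3$-partite $3$-graph with vertex classes $V_1, V_2, V_3$ such that $\tau(\mathcal{H}) = 2\nu(\mathcal{H})$. Then for each $i \in \{1,2,3\}$ we have (i) $\operatorname{conn}(L(\operatorname{lk}_{\mathcal{H}}(V_i))) = \nu(\mathcal{H}) - 2$; (ii) $\nu(\operatorname{lk}_{\mathcal{H}}(V_i)) = \tau(\mathcal{H})$. In particular, $$\operatorname{conn}(L(\operatorname{lk}_{\mathcal{H}}(V_i))) = \frac{\nu(\operatorname{lk}_{\mathcal{H}}(V_i))}{2} - 2.$$
   Context: All hypergraphs are finite. A hypergraph $\mathcal{H}$ has a vertex set $V(\mathcal{H})$ and a multiset $E(\mathcal{H})$ of subsets of vertices, called edges (repeated, i.e. parallel, edges are allowed). An $r$-graph is a hypergraph all of whose edges have cardinality $r$; a graph is a $2$-graph (possibly with parallel edges). An $r$-graph is $r$-partite with vertex classes $V_1,\dots,V_r$ if these partition the vertex set and every edge meets each $V_i$ in exactly one vertex. A matching is a set of pairwise disjoint edges; $\nu(\mathcal{H})$ is the maximum size of a matching. A vertex cover is a set of vertices meeting every edge; $\tau(\mathcal{H})$ is the minimum size of a vertex cover. Link graph: for a $3$-partite $3$-graph $\mathcal{H}$ with classes $V_1,V_2,V_3$ and $S \subseteq V_i$, $\operatorname{lk}_{\mathcal{H}}(S)$ is the bipartite graph with vertex classes $V_j, V_k$ (where $\{i,j,k\}=\{1,2,3\}$) whose edge multiset is $\{e \setminus V_i : e \in E(\mathcal{H}),\ e \cap V_i \subseteq S\}$;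 a pair appears with multiplicity equal to the number of edges of $\mathcal{H}$ containing it together with a vertex of $S$. Line graph: $L(G)$ is the simple graph whose vertex set is $E(G)$ (parallel edges being distinct vertices), with two distinct edges $e, f$ adjacent iff $e \cap f \neq \emptyset$. Connectedness: for an integer $k\ge -1$, a space $X$ is $k$-connected if for every integer $-1\le j\le k$ every continuous map $S^j \to X$ extends to a continuous map $B^{j+1} \to X$ (with $S^{-1}=\emptyset$, so $(-1)$-connected means nonempty). $\operatorname{conn}(X)$ is the largest $k$ such that $X$ is $k$-connected; it is $-2$ if $X$ is empty and $+\infty$ if $X$ is $k$-connected for all $k$. For a graph $H$, $\operatorname{conn}(H)$ means $\operatorname{conn}$ of (the geometric realization of) the independence complex of $H$, i.e. the abstract simplicial complex on $V(H)$ whose simplices are the independent sets of $H$. *)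

theory Defs
  imports "HOL-Analysis.Analysis" "HOL-Library.Multiset"
begin

section \<open>Hypergraphs\<close>

record 'a hypergraph =
  vertices :: "'a set"
  edges :: "'a set multiset"

definition r_graph :: "nat \<Rightarrow> 'a hypergraph \<Rightarrow> bool" where
  "r_graph r H \<longleftrightarrow>
     finite (vertices H) \<and> (\<forall>e \<in># edges H. e \<subseteq> vertices H \<and> card e = r)"

text \<open>The classes are indexed by \<open>1, \<dots>, r\<close>; a class may be empty (then there are no edges).\<close>

definition r_partite :: "nat \<Rightarrow> (nat \<Rightarrow> 'a set) \<Rightarrow> 'a hypergraph \<Rightarrow> bool" where
  "r_partite r V H \<longleftrightarrow>
     disjoint_family_on V {1..r} \<and> (\<Union>i\<in>{1..r}. V i) = vertices H \<and>
     (\<forall>e \<in># edges H. \<forall>i\<in>{1..r}. card (e \<inter> V i) = 1)"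

text \<open>The individual edges: the \<open>m\<close> parallel copies of an edge \<open>e\<close> of multiplicity \<open>m\<close> are
  \<open>(e, 0), \<dots>, (e, m - 1)\<close>.\<close>

definition edge_copies :: "'a hypergraph \<Rightarrow> ('a set \<times> nat) set" where
  "edge_copies H = {(e, k). k < count (edges H) e}"

definition matching :: "'a hypergraph \<Rightarrow> ('a set \<times> nat) set \<Rightarrow> bool" where
  "matching H M \<longleftrightarrow> M \<subseteq> edge_copies H \<and> pairwise (\<lambda>x y. fst x \<inter> fst y = {}) M"

definition matching_number :: "'a hypergraph \<Rightarrow> nat" where
  "matching_number H = Max (card ` {M. matching H M})"

definition vertex_cover :: "'a hypergraph \<Rightarrow> 'a set \<Rightarrow> bool" where
  "vertex_cover H C \<longleftrightarrow> C \<subseteq> vertices H \<and> (\<forall>e \<in># edges H. e \<inter> C \<noteq> {})"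

definition cover_number :: "'a hypergraph \<Rightarrow> nat" where
  "cover_number H = Min (card ` {C. vertex_cover H C})"

text \<open>The link of a set \<open>S \<subseteq> A\<close>, where \<open>A\<close> is one of the vertex classes of \<open>H\<close>.\<close>

definition link :: "'a hypergraph \<Rightarrow> 'a set \<Rightarrow> 'a set \<Rightarrow> 'a hypergraph" where
  "link H A S =
     \<lparr>vertices = vertices H - A,
      edges = image_mset (\<lambda>e. e - A) (filter_mset (\<lambda>e. e \<inter> A \<subseteq> S) (edges H))\<rparr>"

definition line_graph :: "'a hypergraph \<Rightarrow> ('a set \<times> nat) hypergraph" where
  "line_graph G =
     \<lparr>vertices = edge_copies G,
      edges = mset_set {{x, y} | x y. x \<in> edge_copies G \<and> y \<in> edge_copies G \<and>
                                      x \<noteq> y \<and> fst x \<inter> fst y \<noteq> {}}\<rparr>"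


section \<open>Independence complexes\<close>

definition independence_complex :: "'a hypergraph \<Rightarrow> 'a set set" where
  "independence_complex G = {I. I \<subseteq> vertices G \<and> (\<forall>e \<in># edges G. \<not> e \<subseteq> I)}"

text \<open>Barycentric coordinates with the product topology, which is the usual topology of the
  geometric realization when the complex is finite (in general one needs the weak topology).
  The empty simplex contributes no point.\<close>

definition geometric_realization :: "'v set set \<Rightarrow> ('v \<Rightarrow> real) topology" where
  "geometric_realization K =
     subtopology (powertop_real UNIV)
       {x. (\<forall>v. 0 \<le> x v) \<and> {v. x v \<noteq> 0} \<in> K \<and> (\<Sum>v | x v \<noteq> 0. x v) = 1}"


section \<open>Topological connectedness\<close>

text \<open>The sphere of dimension \<open>j\<close>, for \<open>j \<ge> -1\<close>.\<close>

definition sphere_top :: "int \<Rightarrow> (nat \<Rightarrow> real) topology" where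
  "sphere_top j = (if j < 0 then trivial_topology else nsphere (nat j))"

definition ball_top :: "nat \<Rightarrow> (nat \<Rightarrow> real) topology" where
  "ball_top n = subtopology (Euclidean_space n) {x. (\<Sum>i<n. (x i)\<^sup>2) \<le> 1}"

definition k_connected :: "int \<Rightarrow> 'b topology \<Rightarrow> bool" where
  "k_connected k X \<longleftrightarrow>
     (\<forall>j\<in>{-1..k}. \<forall>f. continuous_map (sphere_top j) X f \<longrightarrow>
        (\<exists>g. continuous_map (ball_top (nat (j + 1))) X g \<and>
             (\<forall>x\<in>topspace (sphere_top j). g x = f x)))"

definition conn :: "'b topology \<Rightarrow> ereal" where
  "conn X =
     (if topspace X = {} then -2
      else if \<forall>k\<ge>-1. k_connected k X then \<infinity>
      else ereal (of_int (GREATEST k. -1 \<le> k \<and> k_connected k X)))"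

definition graph_conn :: "'a hypergraph \<Rightarrow> ereal" where
  "graph_conn G = conn (geometric_realization (independence_complex G))"

end

theory Submission
  imports Defs
begin

text \<open>
Let \<open>A\<close> be one of the vertex classes, \<open>E\<close> the edges of its link and \<open>\<nu>\<close> the matching number of the
hypergraph, so that the covering number is \<open>2 * \<nu>\<close>. The independent sets of the line graph of the
link are the matchings in \<open>E\<close>, so the subject is the matching complex of \<open>E\<close>.

Lower bounds on connectedness come from matchings: a matching of size \<open>n\<close> in a graph forces the matching
complex to be \<open>k\<close>-connected whenever \<open>2 * k + 3 \<le> n\<close> (\<open>fills_matching_complex\<close>). The proof removes one
edge at a time and uses that a union of two open sets is \<open>k\<close>-connected if both are and their
intersection is \<open>(k-1)\<close>-connected (\<open>fills_union\<close>).

Large matchings come from the covering number. Colour each edge of the link by a vertex of \<open>A\<close> that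
completes it to an edge of the hypergraph (\<open>link_apex\<close>). For \<open>T \<subseteq> A\<close>, a cover of the edges with
colour outside \<open>T\<close>, together with \<open>T\<close>, covers the hypergraph; by the theorem of Koenig (\<open>konig\<close>) these edges
contain a matching of size at least \<open>2 * \<nu> - card T\<close>. For \<open>T = {}\<close> this shows that the link has a matching
of size \<open>2 * \<nu>\<close> and that its matching complex is \<open>(\<nu> - 2)\<close>-connected.

Upper bounds come from the fact that the hypergraph has no \<open>\<nu> + 1\<close> disjoint edges, i.e. no matching in
the link has more than \<open>\<nu>\<close> colours (\<open>rainbow_matching_lifts\<close>). The topological Hall
theorem (\<open>rainbow_simplex\<close>) produces such a matching if for each \<open>T\<close> the matchings that avoid the colours
in \<open>T\<close> form a \<open>(\<nu> - 1 - card T)\<close>-connected complex. For nonempty \<open>T\<close> this follows from the bound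
\<open>2 * \<nu> - card T\<close> above. Hence it must fail for \<open>T = {}\<close>: the matching complex of the whole link is not
\<open>(\<nu> - 1)\<close>-connected. A matching of size \<open>2 * \<nu> + 1\<close> in the link would make it so; therefore
the matching number of the link is exactly \<open>2 * \<nu>\<close>.

All connectedness statements are phrased with \<open>fills d X\<close>, which says that every map from the
boundary of the \<open>d\<close>-dimensional cube into \<open>X\<close> extends over the cube; \<open>X\<close> is \<open>k\<close>-connected if and only if this
holds for all \<open>d \<le> k + 1\<close> (\<open>k_connected_iff_fills\<close>).
\<close>

section \<open>Extending maps from spheres and from boundaries of cubes\<close>

lemma continuous_on_coord: "continuous_on S (\<lambda>x. x i)"
  by (rule continuous_on_product_then_coordinatewise[OF continuous_on_id])

definition coord_space :: "nat \<Rightarrow> (nat \<Rightarrow> real) set" where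
  "coord_space d = {x. \<forall>i\<ge>d. x i = 0}"

text \<open>A norm on \<open>coord_space d\<close> stripped of the triangle inequality: what remains is all that is
needed to compare the unit balls of two norms by radial rescaling.\<close>

definition gauge_norm :: "nat \<Rightarrow> ((nat \<Rightarrow> real) \<Rightarrow> real) \<Rightarrow> bool" where
  "gauge_norm d N \<longleftrightarrow> continuous_on UNIV N \<and> (\<forall>x. 0 \<le> N x) \<and>
     (\<forall>c x. 0 \<le> c \<longrightarrow> N (\<lambda>i. c * x i) = c * N x) \<and>
     (\<exists>c. \<forall>x \<in> coord_space d. \<forall>i. \<bar>x i\<bar> \<le> c * N x)"

text \<open>For \<open>d = 0\<close> the sphere is empty and the ball is the origin, so the condition says that \<open>X\<close> is
nonempty; this agrees with the convention for \<open>(-1)\<close>-connectedness.\<close>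

definition fills_ball :: "((nat \<Rightarrow> real) \<Rightarrow> real) \<Rightarrow> nat \<Rightarrow> 'b::topological_space set \<Rightarrow> bool" where
  "fills_ball N d X \<longleftrightarrow>
     (\<forall>f. continuous_on {x \<in> coord_space d. N x = 1} f \<longrightarrow> f ` {x \<in> coord_space d. N x = 1} \<subseteq> X \<longrightarrow>
       (\<exists>g. continuous_on {x \<in> coord_space d. N x \<le> 1} g \<and> g ` {x \<in> coord_space d. N x \<le> 1} \<subseteq> X \<and>
            (\<forall>x \<in> coord_space d. N x = 1 \<longrightarrow> g x = f x)))"

lemma gauge_normD:
  assumes "gauge_norm d N"
  shows "continuous_on S N" "0 \<le> N x" "0 \<le> c \<Longrightarrow> N (\<lambda>i. c * x i) = c * N x"
  using assms unfolding gauge_norm_def by (auto intro: continuous_on_subset)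

lemma gauge_norm_zero:
  assumes "gauge_norm d N" shows "N (\<lambda>i. 0) = 0"
  using gauge_normD(3)[OF assms, of 0 "\<lambda>i. 0"] by simp

lemma gauge_norm_eq_0_iff:
  assumes "gauge_norm d N" "x \<in> coord_space d"
  shows "N x = 0 \<longleftrightarrow> x = (\<lambda>i. 0)"
proof
  assume "N x = 0"
  then show "x = (\<lambda>i. 0)" using assms unfolding gauge_norm_def by fastforce
qed (simp add: gauge_norm_zero[OF assms(1)])

lemma coord_space_scale: "x \<in> coord_space d \<Longrightarrow> (\<lambda>i. c * x i) \<in> coord_space d"
  by (simp add: coord_space_def)

text \<open>Only the origin needs an argument. There the quotient has the default value \<open>0\<close>, and the
bound \<open>\<bar>x i\<bar> \<le> c * N x\<close> of a gauge turns the rescaled coordinate into something of size at most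
\<open>c * M x\<close>, which tends to \<open>0\<close>.\<close>

lemma continuous_on_radial_rescaling:
  assumes N: "gauge_norm d N" and M: "gauge_norm d M"
  shows "continuous_on (coord_space d) (\<lambda>x i. (M x / N x) * x i)"
proof (rule continuous_on_coordinatewise_then_product)
  fix i
  obtain c where c: "\<And>x i. x \<in> coord_space d \<Longrightarrow> \<bar>x i\<bar> \<le> c * N x"
    using N unfolding gauge_norm_def by blast
  show "continuous_on (coord_space d) (\<lambda>x. (M x / N x) * x i)"
    unfolding continuous_on_def
  proof
    fix x assume x: "x \<in> coord_space d"
    have tN: "(N \<longlongrightarrow> N x) (at x within coord_space d)" 
      and tM: "(M \<longlongrightarrow> M x) (at x within coord_space d)"
      using gauge_normD(1)[OF N] gauge_normD(1)[OF M] x unfolding continuous_on_def by blast+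
    have ti: "((\<lambda>x. x i) \<longlongrightarrow> x i) (at x within coord_space d)"
      using continuous_on_subset[OF continuous_on_product_coordinates[of i] subset_UNIV] x
      unfolding continuous_on_def by blast
    show "((\<lambda>x. (M x / N x) * x i) \<longlongrightarrow> (M x / N x) * x i) (at x within coord_space d)"
    proof (cases "N x = 0")
      case False
      then show ?thesis by (intro tendsto_intros tN tM ti)
    next
      case True
      then have x0: "x = (\<lambda>i. 0)" using gauge_norm_eq_0_iff[OF N x] by blast
      have Mx: "M x = 0" using gauge_norm_zero[OF M] x0 by simp
      have bnd: "\<bar>(M y / N y) * y i\<bar> \<le> \<bar>c\<bar> * M y" if "y \<in> coord_space d" for y
      proof (cases "N y = 0")
        case True
        then show ?thesis using gauge_normD(2)[OF M, of y] by simp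
      next
        case False
        then have pos: "N y > 0" using gauge_normD(2)[OF N, of y] by linarith
        have "\<bar>y i\<bar> \<le> \<bar>c\<bar> * N y"
          using c[OF that, of i] pos by (meson abs_ge_self mult_right_mono less_imp_le order_trans)
        then have "M y * \<bar>y i\<bar> \<le> M y * (\<bar>c\<bar> * N y)"
          using gauge_normD(2)[OF M, of y] by (rule mult_left_mono)
        then show ?thesis using pos gauge_normD(2)[OF M, of y]
          by (simp add: abs_mult field_simps)
      qed
      have "((\<lambda>y. \<bar>c\<bar> * M y) \<longlongrightarrow> \<bar>c\<bar> * M x) (at x within coord_space d)"
        by (intro tendsto_intros tM)
      then have "((\<lambda>y. \<bar>c\<bar> * M y) \<longlongrightarrow> 0) (at x within coord_space d)" using Mx by simp
      then have "((\<lambda>y. (M y / N y) * y i) \<longlongrightarrow> 0) (at x within coord_space d)"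
        by (rule Lim_null_comparison[rotated])
           (use bnd in \<open>auto simp: eventually_at_filter\<close>)
      then show ?thesis using x0 by simp
    qed
  qed
qed

text \<open>The two radial rescalings are mutually inverse and exchange the unit balls and unit spheres of
\<open>N\<close> and \<open>M\<close>. Hence round spheres, which occur in the definition of connectedness, may be replaced
by boundaries of cubes, which can be cut into smaller cubes.\<close>

lemma fills_ball_transfer:
  assumes N: "gauge_norm d N" and M: "gauge_norm d M" and X: "fills_ball N d X"
  shows "fills_ball M d X"
  unfolding fills_ball_def
proof (intro allI impI)
  let ?E = "coord_space d"
  fix f :: "(nat \<Rightarrow> real) \<Rightarrow> 'a"
  assume f: "continuous_on {x \<in> ?E. M x = 1} f" and fX: "f ` {x \<in> ?E. M x = 1} \<subseteq> X"
  define q where "q x = (\<lambda>i. (N x / M x) * x i)" for x :: "nat \<Rightarrow> real"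
  define r where "r x = (\<lambda>i. (M x / N x) * x i)" for x :: "nat \<Rightarrow> real"
  have cq: "continuous_on ?E q" and cr: "continuous_on ?E r"
    unfolding q_def r_def by (rule continuous_on_radial_rescaling[OF M N],
      rule continuous_on_radial_rescaling[OF N M])
  have qE: "q x \<in> ?E" and rE: "r x \<in> ?E" if "x \<in> ?E" for x
    using that by (auto simp: q_def r_def coord_space_def)
  have Mq: "M (q x) = N x" and Nr: "N (r x) = M x" and qr: "q (r x) = x"
    if x: "x \<in> ?E" for x
  proof -
    have z: "N x = 0 \<longleftrightarrow> M x = 0"
      using gauge_norm_eq_0_iff[OF N x] gauge_norm_eq_0_iff[OF M x] by simp
    show "M (q x) = N x" unfolding q_def
      using gauge_normD(2)[OF N, of x] gauge_normD(2)[OF M, of x] z by (subst gauge_normD(3)[OF M]) auto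
    show Nr: "N (r x) = M x" unfolding r_def
      using gauge_normD(2)[OF N, of x] gauge_normD(2)[OF M, of x] z by (subst gauge_normD(3)[OF N]) auto
    have "M (r x) = (M x / N x) * M x" unfolding r_def
      using gauge_normD(2)[OF N, of x] gauge_normD(2)[OF M, of x] z by (subst gauge_normD(3)[OF M]) auto
    then show "q (r x) = x"
      using z gauge_norm_eq_0_iff[OF N x] unfolding q_def Nr by (auto simp: r_def fun_eq_iff)
  qed
  have "continuous_on {x \<in> ?E. N x = 1} (f \<circ> q)"
    by (intro continuous_on_compose continuous_on_subset[OF cq] continuous_on_subset[OF f])
       (auto simp: qE Mq)
  moreover have "(f \<circ> q) ` {x \<in> ?E. N x = 1} \<subseteq> X" using fX by (auto simp: qE Mq)
  ultimately obtain g where g: "continuous_on {x \<in> ?E. N x \<le> 1} g"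
    and gX: "g ` {x \<in> ?E. N x \<le> 1} \<subseteq> X"
    and gf: "\<And>x. x \<in> ?E \<Longrightarrow> N x = 1 \<Longrightarrow> g x = f (q x)"
    using X unfolding fills_ball_def by (metis (no_types, lifting) comp_apply)
  have "continuous_on {x \<in> ?E. M x \<le> 1} (g \<circ> r)"
    by (intro continuous_on_compose continuous_on_subset[OF cr] continuous_on_subset[OF g])
       (auto simp: rE Nr)
  moreover have "(g \<circ> r) ` {x \<in> ?E. M x \<le> 1} \<subseteq> X" using gX by (auto simp: rE Nr)
  moreover have "\<forall>x \<in> ?E. M x = 1 \<longrightarrow> (g \<circ> r) x = f x" using gf by (simp add: rE Nr qr)
  ultimately show "\<exists>g. continuous_on {x \<in> ?E. M x \<le> 1} g \<and> g ` {x \<in> ?E. M x \<le> 1} \<subseteq> X \<and>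
      (\<forall>x \<in> ?E. M x = 1 \<longrightarrow> g x = f x)" by blast
qed

lemma gauge_norm_L2: "gauge_norm d (\<lambda>x. L2_set x {..<d})"
  unfolding gauge_norm_def
proof (intro conjI allI impI exI[of _ 1] ballI)
  show "continuous_on UNIV (\<lambda>x::nat \<Rightarrow> real. L2_set x {..<d})"
    unfolding L2_set_def by (intro continuous_intros) auto
  show "L2_set (\<lambda>i. c * x i) {..<d} = c * L2_set x {..<d}" if "0 \<le> c" for c and x :: "nat \<Rightarrow> real"
    by (simp add: L2_set_right_distrib[OF that])
  show "\<bar>x i\<bar> \<le> 1 * L2_set x {..<d}" if "x \<in> coord_space d" for x i
  proof (cases "i < d")
    case True
    then have "\<bar>x i\<bar> \<le> L2_set (\<lambda>i. \<bar>x i\<bar>) {..<d}" by (intro member_le_L2_set) auto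
    then show ?thesis by (simp add: L2_set_def)
  qed (use that in \<open>auto simp: coord_space_def L2_set_nonneg\<close>)
qed (simp add: L2_set_nonneg)

text \<open>The maximum of the absolute values of the first \<open>d\<close> coordinates, by recursion on \<open>d\<close> so that its
continuity is a plain induction.\<close>

primrec sup_norm :: "nat \<Rightarrow> (nat \<Rightarrow> real) \<Rightarrow> real" where
  "sup_norm 0 x = 0"
| "sup_norm (Suc d) x = max (sup_norm d x) \<bar>x d\<bar>"

lemma sup_norm_nonneg: "0 \<le> sup_norm d x"
  by (induction d) auto

lemma sup_norm_le_iff: "0 \<le> r \<Longrightarrow> sup_norm d x \<le> r \<longleftrightarrow> (\<forall>i<d. \<bar>x i\<bar> \<le> r)"
  by (induction d) (auto simp: less_Suc_eq)

lemma sup_norm_attained: "sup_norm d x \<noteq> 0 \<Longrightarrow> \<exists>i<d. sup_norm d x = \<bar>x i\<bar>"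
  by (induction d) (auto simp: max_def less_Suc_eq split: if_splits)

lemma sup_norm_eq_1_iff:
  "sup_norm d x = 1 \<longleftrightarrow> (\<forall>i<d. \<bar>x i\<bar> \<le> 1) \<and> (\<exists>i<d. \<bar>x i\<bar> = 1)"
  using sup_norm_attained[of d x] sup_norm_le_iff[of 1 d x] sup_norm_le_iff[of "sup_norm d x" d x] 
    sup_norm_nonneg[of d x]
  by (metis antisym order_refl zero_le_one zero_neq_one)

lemma gauge_norm_sup: "gauge_norm d (sup_norm d)"
  unfolding gauge_norm_def
proof (intro conjI allI impI exI[of _ 1] ballI)
  show "continuous_on UNIV (sup_norm d)"
    by (induction d) (auto intro!: continuous_intros)
  show "0 \<le> sup_norm d x" for x by (rule sup_norm_nonneg)
  show "sup_norm d (\<lambda>i. c * x i) = c * sup_norm d x" if "0 \<le> c" for c x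
    using that by (induction d) (auto simp: abs_mult max_mult_distrib_left)
  show "\<bar>x i\<bar> \<le> 1 * sup_norm d x" if "x \<in> coord_space d" for x i
    using that sup_norm_le_iff[of "sup_norm d x" d x] sup_norm_nonneg[of d x] 
    by (cases "i < d") (auto simp: coord_space_def)
qed

abbreviation cube :: "nat \<Rightarrow> (nat \<Rightarrow> real) set" where
  "cube d \<equiv> {x \<in> coord_space d. sup_norm d x \<le> 1}"

abbreviation shell :: "nat \<Rightarrow> (nat \<Rightarrow> real) set" where
  "shell d \<equiv> {x \<in> coord_space d. sup_norm d x = 1}"

definition fills :: "nat \<Rightarrow> 'b::topological_space set \<Rightarrow> bool" where
  "fills d = fills_ball (sup_norm d) d"

lemma fillsD:
  assumes "fills d X" "continuous_on (shell d) f" "f ` shell d \<subseteq> X"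
  obtains g where "continuous_on (cube d) g" "g ` cube d \<subseteq> X" "\<And>x. x \<in> shell d \<Longrightarrow> g x = f x"
proof -
  have "\<exists>g. continuous_on (cube d) g \<and> g ` cube d \<subseteq> X \<and>
      (\<forall>x \<in> coord_space d. sup_norm d x = 1 \<longrightarrow> g x = f x)"
    using assms unfolding fills_def fills_ball_def by blast
  then show thesis using that by auto
qed

lemma fillsI:
  assumes "\<And>f. continuous_on (shell d) f \<Longrightarrow> f ` shell d \<subseteq> X \<Longrightarrow>
    \<exists>g. continuous_on (cube d) g \<and> g ` cube d \<subseteq> X \<and> (\<forall>x \<in> shell d. g x = f x)"
  shows "fills d X"
proof -
  have "\<exists>g. continuous_on (cube d) g \<and> g ` cube d \<subseteq> X \<and>
      (\<forall>x \<in> coord_space d. sup_norm d x = 1 \<longrightarrow> g x = f x)"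
    if "continuous_on (shell d) f" "f ` shell d \<subseteq> X" for f
    using assms[OF that] by auto
  then show ?thesis unfolding fills_def fills_ball_def by blast
qed

lemma continuous_map_iff_continuous_on:
  "continuous_map (top_of_set S) (top_of_set T) f \<longleftrightarrow> continuous_on S f \<and> f ` S \<subseteq> T"
  by (auto simp: continuous_map_in_subtopology)

lemma sphere_top_eq:
  "sphere_top (int d - 1) = top_of_set {x \<in> coord_space d. L2_set x {..<d} = 1}"
proof (cases d)
  case 0
  then show ?thesis by (simp add: sphere_top_def)
next
  case (Suc m)
  have "(\<Sum>i\<le>m. x i ^ 2) = 1 \<longleftrightarrow> L2_set x {..<d} = 1" for x :: "nat \<Rightarrow> real"
    by (simp add: L2_set_def Suc lessThan_Suc_atMost)
  then show ?thesis
    using Suc by (auto simp: sphere_top_def nsphere euclidean_product_topology coord_space_def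
        Suc_le_eq intro!: arg_cong[where f = top_of_set])
qed

lemma ball_top_eq: "ball_top d = top_of_set {x \<in> coord_space d. L2_set x {..<d} \<le> 1}"
  by (auto simp: ball_top_def Euclidean_space_def subtopology_subtopology euclidean_product_topology
      coord_space_def L2_set_def intro!: arg_cong[where f = top_of_set])

text \<open>The shift by one comes from indexing \<open>fills\<close> by the dimension of the ball instead of the
dimension of its boundary sphere.\<close>

lemma k_connected_iff_fills:
  "k_connected k (top_of_set X) \<longleftrightarrow> (\<forall>d. int d \<le> k + 1 \<longrightarrow> fills d X)"
proof -
  have fb: "fills d X \<longleftrightarrow> fills_ball (\<lambda>x. L2_set x {..<d}) d X" for d
    using fills_ball_transfer[OF gauge_norm_L2 gauge_norm_sup]
      fills_ball_transfer[OF gauge_norm_sup gauge_norm_L2] unfolding fills_def by blast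
  have eq: "fills d X \<longleftrightarrow> (\<forall>f. continuous_map (sphere_top (int d - 1)) (top_of_set X) f \<longrightarrow>
        (\<exists>g. continuous_map (ball_top d) (top_of_set X) g \<and>
             (\<forall>x\<in>topspace (sphere_top (int d - 1)). g x = f x)))" for d
    unfolding fb fills_ball_def sphere_top_eq ball_top_eq continuous_map_iff_continuous_on
    by (simp add: imp_conjL Ball_def)
  show ?thesis
  proof
    assume L: "k_connected k (top_of_set X)"
    show "\<forall>d. int d \<le> k + 1 \<longrightarrow> fills d X"
    proof (intro allI impI)
      fix d assume "int d \<le> k + 1"
      then have "int d - 1 \<in> {-1..k}" by auto
      then show "fills d X" using L unfolding k_connected_def eq by fastforce
    qed
  next
    assume R: "\<forall>d. int d \<le> k + 1 \<longrightarrow> fills d X"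
    show "k_connected k (top_of_set X)" unfolding k_connected_def
    proof
      fix j assume "j \<in> {-1..k}"
      then have *: "int (nat (j + 1)) - 1 = j" "int (nat (j + 1)) \<le> k + 1" by auto
      show "\<forall>f. continuous_map (sphere_top j) (top_of_set X) f \<longrightarrow>
        (\<exists>g. continuous_map (ball_top (nat (j + 1))) (top_of_set X) g \<and>
             (\<forall>x\<in>topspace (sphere_top j). g x = f x))"
        using R[rule_format, OF *(2)] unfolding eq *(1) .
    qed
  qed
qed

lemma fills_0_iff: "fills 0 X \<longleftrightarrow> X \<noteq> {}"
proof
  assume "fills 0 X"
  then obtain g where "g ` cube 0 \<subseteq> X" by (rule fillsD[of _ _ "\<lambda>_. undefined"]) auto
  moreover have "(\<lambda>i. 0) \<in> cube 0" by (simp add: coord_space_def)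
  ultimately show "X \<noteq> {}" by blast
next
  assume "X \<noteq> {}"
  then obtain p where "p \<in> X" by blast
  then show "fills 0 X" by (intro fillsI exI[of _ "\<lambda>_. p"]) auto
qed

text \<open>A map on the boundary of the cube extends as soon as it is homotopic in \<open>X\<close> to one that extends:
run through the homotopy in the collar where the maximum norm is at least \<open>1/2\<close>, and put a
shrunken copy of the extension \<open>g\<close> inside.\<close>

lemma fills_homotopy:
  assumes hom: "continuous_on ({0..1::real} \<times> shell d) (\<lambda>(t, x). h t x)"
    and hX: "\<And>t x. t \<in> {0..1} \<Longrightarrow> x \<in> shell d \<Longrightarrow> h t x \<in> X"
    and g: "continuous_on (cube d) g" "g ` cube d \<subseteq> X"
    and h1: "\<And>x. x \<in> shell d \<Longrightarrow> h 1 x = g x"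
  obtains g' where "continuous_on (cube d) g'" "g' ` cube d \<subseteq> X"
    "\<And>x. x \<in> shell d \<Longrightarrow> g' x = h 0 x"
proof -
  let ?N = "sup_norm d"
  have N: "gauge_norm d ?N" by (rule gauge_norm_sup)
  define A where "A = {x \<in> coord_space d. ?N x \<le> 1/2}"
  define B where "B = {x \<in> coord_space d. 1/2 \<le> ?N x \<and> ?N x \<le> 1}"
  define u where "u x = (\<lambda>i. (1 / ?N x) * x i)" for x
  define inner where "inner x = g (\<lambda>i. 2 * x i)" for x
  define outer where "outer x = h (2 - 2 * ?N x) (u x)" for x
  define g' where "g' x = (if x \<in> A then inner x else outer x)" for x
  have uS: "u x \<in> shell d" if "x \<in> B" for x
    using that gauge_normD(3)[OF N, of "1 / ?N x" x]
    by (auto simp: u_def B_def coord_space_def)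
  have cu: "continuous_on B u" unfolding u_def
    by (intro continuous_intros gauge_normD(1)[OF N] continuous_on_coord)
       (auto simp: B_def)
  have co: "continuous_on B outer"
  proof -
    have "continuous_on B (\<lambda>x. (2 - 2 * ?N x, u x))"
      by (intro continuous_intros gauge_normD(1)[OF N] cu)
    moreover have "(\<lambda>x. (2 - 2 * ?N x, u x)) ` B \<subseteq> {0..1} \<times> shell d"
      using uS by (auto simp: B_def)
    ultimately have "continuous_on B ((\<lambda>(t, x). h t x) \<circ> (\<lambda>x. (2 - 2 * ?N x, u x)))"
      by (intro continuous_on_compose continuous_on_subset[OF hom])
    then show ?thesis by (simp add: outer_def comp_def)
  qed
  have dbl: "(\<lambda>i. 2 * x i) \<in> cube d" if "x \<in> A" for x
    using that coord_space_scale[of x d 2] gauge_normD(3)[OF N, of 2 x] by (auto simp: A_def)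
  have ci: "continuous_on A inner"
  proof -
    have "continuous_on A (\<lambda>x i. 2 * x i)"
      by (intro continuous_intros continuous_on_coord)
    then have "continuous_on A (g \<circ> (\<lambda>x i. 2 * x i))"
      using dbl by (intro continuous_on_compose continuous_on_subset[OF g(1)]) auto
    then show ?thesis by (simp add: inner_def comp_def)
  qed
  have agree: "inner x = outer x" if "x \<in> A" "x \<in> B" for x
  proof -
    have half: "?N x = 1/2" using that by (auto simp: A_def B_def)
    then have u: "u x = (\<lambda>i. 2 * x i)" unfolding u_def half by simp
    have t: "2 - 2 * ?N x = 1" using half by simp
    show ?thesis using h1[OF uS[OF that(2)]] unfolding inner_def outer_def t u by simp
  qed
  have cN: "continuous_on (cube d) ?N" by (rule gauge_normD(1)[OF N])
  have clA: "closedin (top_of_set (cube d)) A"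
  proof -
    have "A = cube d \<inter> ?N -` {..1/2}" by (auto simp: A_def)
    then show ?thesis using continuous_closedin_preimage[OF cN closed_atMost] by simp
  qed
  have clB: "closedin (top_of_set (cube d)) B"
  proof -
    have "B = cube d \<inter> ?N -` {1/2..}" by (auto simp: B_def)
    then show ?thesis using continuous_closedin_preimage[OF cN closed_atLeast] by simp
  qed
  have AB: "A \<union> B = cube d" by (auto simp: A_def B_def)
  have "continuous_on (A \<union> B) (\<lambda>x. if x \<in> A then inner x else outer x)"
    by (rule continuous_on_cases_local) (use clA clB AB ci co agree in auto)
  then have 1: "continuous_on (cube d) g'" using AB by (simp add: g'_def[abs_def])
  have 2: "g' ` cube d \<subseteq> X"
  proof
    fix y assume "y \<in> g' ` cube d"
    then obtain x where x: "x \<in> cube d" "y = g' x" by blast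
    show "y \<in> X"
    proof (cases "x \<in> A")
      case True
      then show ?thesis using x dbl[OF True] g(2) by (auto simp: g'_def inner_def)
    next
      case False
      then have xB: "x \<in> B" using x AB by blast
      have "2 - 2 * ?N x \<in> {0..1}" using xB by (auto simp: B_def)
      then show ?thesis using hX[OF _ uS[OF xB]] x False by (simp add: g'_def outer_def)
    qed
  qed
  have 3: "g' x = h 0 x" if "x \<in> shell d" for x
  proof -
    have "x \<notin> A" using that by (auto simp: A_def)
    moreover have "u x = x" using that by (auto simp: u_def)
    ultimately show ?thesis using that by (simp add: g'_def outer_def)
  qed
  show thesis using that[OF 1 2 3] .
qed

text \<open>Homotopy domination is enough to transport connectedness: a sphere in \<open>S\<close> is first pushed into \<open>A\<close>
by \<open>r\<close>, filled there, and brought back by \<open>s\<close>; the homotopy from the identity to \<open>s \<circ> r\<close> repairs the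
boundary values.\<close>

lemma fills_dominated:
  assumes A: "fills d A"
    and r: "continuous_on S r" "r ` S \<subseteq> A" and s: "continuous_on A s" "s ` A \<subseteq> S"
    and h: "continuous_on ({0..1} \<times> S) (\<lambda>(t, x). h t x)"
    and hS: "\<And>t x. t \<in> {0..1::real} \<Longrightarrow> x \<in> S \<Longrightarrow> h t x \<in> S"
    and h0: "\<And>x. x \<in> S \<Longrightarrow> h 0 x = x" and h1: "\<And>x. x \<in> S \<Longrightarrow> h 1 x = s (r x)"
  shows "fills d S"
proof (rule fillsI)
  fix f assume f: "continuous_on (shell d) f" "f ` shell d \<subseteq> S"
  have "continuous_on (shell d) (r \<circ> f)"
    by (intro continuous_on_compose f continuous_on_subset[OF r(1)])
  moreover have "(r \<circ> f) ` shell d \<subseteq> A" using f(2) r(2) by auto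
  ultimately obtain g where g: "continuous_on (cube d) g" "g ` cube d \<subseteq> A"
    "\<And>x. x \<in> shell d \<Longrightarrow> g x = (r \<circ> f) x" using fillsD[OF A] by blast
  have "continuous_on ({0..1} \<times> shell d) (\<lambda>p. (fst p, f (snd p)))"
    by (intro continuous_intros continuous_on_compose2[OF f(1)]) auto
  then have "continuous_on ({0..1} \<times> shell d) ((\<lambda>(t, x). h t x) \<circ> (\<lambda>p. (fst p, f (snd p))))"
    using f(2) by (intro continuous_on_compose continuous_on_subset[OF h]) auto
  then have 1: "continuous_on ({0..1} \<times> shell d) (\<lambda>(t, x). h t (f x))"
    by (simp add: comp_def case_prod_unfold)
  have sg: "continuous_on (cube d) (s \<circ> g)"
    by (intro continuous_on_compose g continuous_on_subset[OF s(1)])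
  obtain g' where g': "continuous_on (cube d) g'" "g' ` cube d \<subseteq> S"
    "\<And>x. x \<in> shell d \<Longrightarrow> g' x = h 0 (f x)"
  proof (rule fills_homotopy[OF 1 _ sg])
    show "(s \<circ> g) ` cube d \<subseteq> S" using g(2) s(2) by auto
    show "h t (f x) \<in> S" if "t \<in> {0..1}" "x \<in> shell d" for t x using that f(2) by (intro hS) auto
    show "h 1 (f x) = (s \<circ> g) x" if "x \<in> shell d" for x
    proof -
      have "f x \<in> S" using that f(2) by blast
      then show ?thesis using h1 g(3)[OF that] by simp
    qed
  qed blast
  have "\<forall>x\<in>shell d. g' x = f x"
  proof
    fix x assume x: "x \<in> shell d"
    then have "f x \<in> S" using f(2) by blast
    then show "g' x = f x" using g'(3)[OF x] h0 by simp
  qed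
  with g'(1,2) show "\<exists>g. continuous_on (cube d) g \<and> g ` cube d \<subseteq> S \<and> (\<forall>x\<in>shell d. g x = f x)"
    by blast
qed

lemma fills_singleton: "fills d {p}"
  by (intro fillsI exI[of _ "\<lambda>_. p"]) auto

lemma fills_contractible:
  assumes p: "p \<in> S"
    and h: "continuous_on ({0..1} \<times> S) (\<lambda>(t, x). h t x)"
    and hS: "\<And>t x. t \<in> {0..1::real} \<Longrightarrow> x \<in> S \<Longrightarrow> h t x \<in> S"
    and h0: "\<And>x. x \<in> S \<Longrightarrow> h 0 x = x" and h1: "\<And>x. x \<in> S \<Longrightarrow> h 1 x = p"
  shows "fills d S"
  by (rule fills_dominated[OF fills_singleton, of S "\<lambda>_. p" p "\<lambda>x. x" h]) (use assms in auto)

section \<open>Extending maps over cubical complexes\<close>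

text \<open>The face of the integer grid with lower corner \<open>a\<close> that has length one in the directions of \<open>J\<close>
and is constant in all others; its dimension is \<open>card J\<close>.\<close>

definition cell :: "(nat \<Rightarrow> int) \<Rightarrow> nat set \<Rightarrow> (nat \<Rightarrow> real) set" where
  "cell a J = {x. \<forall>i. if i \<in> J then real_of_int (a i) \<le> x i \<and> x i \<le> real_of_int (a i) + 1
                  else x i = real_of_int (a i)}"

definition cell_boundary :: "(nat \<Rightarrow> int) \<Rightarrow> nat set \<Rightarrow> (nat \<Rightarrow> real) set" where
  "cell_boundary a J = {x \<in> cell a J. \<exists>i\<in>J. x i = real_of_int (a i) \<or> x i = real_of_int (a i) + 1}"

lemma cell_facets:
  assumes "x \<in> cell_boundary a J"
  obtains i b where "i \<in> J" "b \<in> {a, a(i := a i + 1)}" "x \<in> cell b (J - {i})"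
proof -
  obtain i where i: "i \<in> J" and x: "x \<in> cell a J" and e: "x i = a i \<or> x i = a i + 1"
    using assms unfolding cell_boundary_def by auto
  have "x \<in> cell a (J - {i}) \<or> x \<in> cell (a(i := a i + 1)) (J - {i})"
    using x i e unfolding cell_def by auto
  then show thesis using that i by blast
qed

lemma facet_subset_cell:
  assumes "i \<in> J" "b \<in> {a, a(i := a i + 1)}"
  shows "cell b (J - {i}) \<subseteq> cell a J"
proof
  fix x assume x: "x \<in> cell b (J - {i})"
  show "x \<in> cell a J" unfolding cell_def
  proof (intro CollectI allI)
    fix j
    show "if j \<in> J then real_of_int (a j) \<le> x j \<and> x j \<le> real_of_int (a j) + 1 else x j = real_of_int (a j)"
      using x[unfolded cell_def, THEN CollectD, rule_format, of j] assms
      by (cases "j = i") (auto split: if_splits)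
  qed
qed

text \<open>At an interior point of \<open>cell a J\<close> the coordinates in \<open>J\<close> are not integers, so each grid cell
containing the point is free in all of these directions. A second cell of no larger dimension is
then free in exactly these, and the integer parts determine its corner.\<close>

lemma cell_interiors_disjoint:
  assumes "x \<in> cell a J" "x \<notin> cell_boundary a J" "x \<in> cell b K"
    and "finite J" "finite K" "card K \<le> card J"
  shows "a = b \<and> J = K"
proof -
  have aJ: "real_of_int (a i) < x i \<and> x i < real_of_int (a i) + 1" if "i \<in> J" for i
    using assms(1,2) that unfolding cell_def cell_boundary_def by (smt (verit) mem_Collect_eq)
  have "J \<subseteq> K"
  proof
    fix i assume i: "i \<in> J"
    show "i \<in> K"
    proof (rule ccontr)
      assume "i \<notin> K"
      then have "x i = real_of_int (b i)" using assms(3) unfolding cell_def by (smt (verit) mem_Collect_eq)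
      with aJ[OF i] have "real_of_int (a i) < real_of_int (b i)" "real_of_int (b i) < real_of_int (a i + 1)" by auto
      then show False unfolding of_int_less_iff by simp
    qed
  qed
  then have JK: "J = K" using assms(5,6) by (metis card_seteq)
  have "a i = b i" for i
  proof (cases "i \<in> J")
    case True
    then have "real_of_int (b i) \<le> x i" "x i \<le> real_of_int (b i) + 1"
      using assms(3) JK unfolding cell_def by (smt (verit) mem_Collect_eq)+
    with aJ[OF True] have "real_of_int (a i) < real_of_int (b i + 1)" "real_of_int (b i) < real_of_int (a i + 1)" by auto
    then show ?thesis unfolding of_int_less_iff by simp
  next
    case False
    then have "x i = real_of_int (a i)" "x i = real_of_int (b i)"
      using assms(1,3) JK unfolding cell_def by (smt (verit) mem_Collect_eq)+
    then show ?thesis by simp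
  qed
  with JK show ?thesis by auto
qed

lemma closed_cell: "closed (cell a J)"
proof -
  have "cell a J = (\<Inter>i. {x. if i \<in> J then real_of_int (a i) \<le> x i \<and> x i \<le> real_of_int (a i) + 1
                  else x i = real_of_int (a i)})" unfolding cell_def by auto
  moreover have "closed {x::nat \<Rightarrow> real. if i \<in> J then real_of_int (a i) \<le> x i \<and> x i \<le> real_of_int (a i) + 1
                  else x i = real_of_int (a i)}" for i
    by (cases "i \<in> J") (auto intro!: closed_Collect_conj closed_Collect_le closed_Collect_eq continuous_on_coord continuous_intros)
  ultimately show ?thesis by (simp add: closed_INT)
qed

lemma fills_cell:
  assumes X: "fills (card J) X" and J: "finite J"
    and f: "continuous_on (cell_boundary a J) f" "f ` cell_boundary a J \<subseteq> X"
  obtains g where "continuous_on (cell a J) g" "g ` cell a J \<subseteq> X"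
    "\<And>x. x \<in> cell_boundary a J \<Longrightarrow> g x = f x"
proof -
  let ?d = "card J"
  obtain \<sigma> where \<sigma>: "bij_betw \<sigma> {..<?d} J"
    using ex_bij_betw_nat_finite[OF J] by (auto simp: atLeast0LessThan)
  define \<tau> where "\<tau> = inv_into {..<?d} \<sigma>"
  have \<tau>: "\<tau> j < ?d" "\<sigma> (\<tau> j) = j" if "j \<in> J" for j
    using \<sigma> that unfolding \<tau>_def bij_betw_def by (metis inv_into_into lessThan_iff, metis f_inv_into_f)
  have \<sigma>J: "\<sigma> i \<in> J" "\<tau> (\<sigma> i) = i" if "i < ?d" for i
    using \<sigma> that unfolding \<tau>_def bij_betw_def by (auto simp: inv_into_f_f)
  define \<phi> where "\<phi> x = (\<lambda>i. if i < ?d then 2 * (x (\<sigma> i) - real_of_int (a (\<sigma> i))) - 1 else 0)" for x :: "nat \<Rightarrow> real"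
  define \<psi> where "\<psi> y = (\<lambda>j. if j \<in> J then real_of_int (a j) + (y (\<tau> j) + 1) / 2 else real_of_int (a j))" for y :: "nat \<Rightarrow> real"
  have c\<phi>: "continuous_on S \<phi>" for S unfolding \<phi>_def
  proof (rule continuous_on_coordinatewise_then_product)
    fix i show "continuous_on S (\<lambda>x. if i < ?d then 2 * (x (\<sigma> i) - real_of_int (a (\<sigma> i))) - 1 else 0)"
      by (cases "i < ?d") (auto intro!: continuous_intros continuous_on_coord)
  qed
  have c\<psi>: "continuous_on S \<psi>" for S unfolding \<psi>_def
  proof (rule continuous_on_coordinatewise_then_product)
    fix j show "continuous_on S (\<lambda>y. if j \<in> J then real_of_int (a j) + (y (\<tau> j) + 1) / 2 else real_of_int (a j))"
      by (cases "j \<in> J") (auto intro!: continuous_intros continuous_on_coord)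
  qed
  have \<psi>\<phi>: "\<psi> (\<phi> x) = x" if "x \<in> cell a J" for x
    using that \<tau> unfolding \<psi>_def \<phi>_def cell_def by (auto simp: fun_eq_iff field_simps)
  have \<phi>cube: "\<phi> x \<in> cube ?d" if "x \<in> cell a J" for x
  proof -
    have "\<bar>\<phi> x i\<bar> \<le> 1" if "i < ?d" for i
      using \<open>x \<in> cell a J\<close>[unfolded cell_def, THEN CollectD, rule_format, of "\<sigma> i"] \<sigma>J[OF that] that
      unfolding \<phi>_def by (auto simp: abs_le_iff)
    then show ?thesis by (auto simp: sup_norm_le_iff coord_space_def) (simp add: \<phi>_def)
  qed
  have \<phi>shell: "\<phi> x \<in> shell ?d" if x: "x \<in> cell_boundary a J" for x
  proof -
    obtain j where j: "j \<in> J" "x j = real_of_int (a j) \<or> x j = real_of_int (a j) + 1" and xc: "x \<in> cell a J"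
      using x unfolding cell_boundary_def by auto
    have "\<bar>\<phi> x (\<tau> j)\<bar> = 1" using j \<tau>[OF j(1)] unfolding \<phi>_def by auto
    then show ?thesis using \<phi>cube[OF xc] \<tau>[OF j(1)] by (auto simp: sup_norm_eq_1_iff sup_norm_le_iff)
  qed
  have \<psi>bd: "\<psi> y \<in> cell_boundary a J" if y: "y \<in> shell ?d" for y
  proof -
    have b: "\<bar>y i\<bar> \<le> 1" if "i < ?d" for i using y that by (auto simp: sup_norm_eq_1_iff)
    obtain i where i: "i < ?d" "\<bar>y i\<bar> = 1" using y by (auto simp: sup_norm_eq_1_iff)
    have "\<psi> y \<in> cell a J" unfolding cell_def
    proof (intro CollectI allI)
      fix j
      show "if j \<in> J then real_of_int (a j) \<le> \<psi> y j \<and> \<psi> y j \<le> real_of_int (a j) + 1 else \<psi> y j = real_of_int (a j)"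
        using b[OF \<tau>(1), of j] by (auto simp: \<psi>_def abs_le_iff)
    qed
    moreover have "\<psi> y (\<sigma> i) = a (\<sigma> i) \<or> \<psi> y (\<sigma> i) = a (\<sigma> i) + 1"
      using i \<sigma>J[OF i(1)] by (auto simp: \<psi>_def abs_if split: if_splits)
    ultimately show ?thesis using \<sigma>J[OF i(1)] unfolding cell_boundary_def by auto
  qed
  have "continuous_on (shell ?d) (f \<circ> \<psi>)"
    by (intro continuous_on_compose c\<psi> continuous_on_subset[OF f(1)]) (use \<psi>bd in auto)
  moreover have "(f \<circ> \<psi>) ` shell ?d \<subseteq> X" using f(2) \<psi>bd by auto
  ultimately obtain g where g: "continuous_on (cube ?d) g" "g ` cube ?d \<subseteq> X"
    "\<And>y. y \<in> shell ?d \<Longrightarrow> g y = (f \<circ> \<psi>) y" using fillsD[OF X] by blast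
  show thesis
  proof (rule that[of "g \<circ> \<phi>"])
    show "continuous_on (cell a J) (g \<circ> \<phi>)"
      by (intro continuous_on_compose c\<phi> continuous_on_subset[OF g(1)]) (use \<phi>cube in auto)
    show "(g \<circ> \<phi>) ` cell a J \<subseteq> X" using g(2) \<phi>cube by auto
    show "(g \<circ> \<phi>) x = f x" if x: "x \<in> cell_boundary a J" for x
    proof -
      have "x \<in> cell a J" using x unfolding cell_boundary_def by auto
      then show ?thesis using g(3)[OF \<phi>shell[OF x]] \<psi>\<phi> by simp
    qed
  qed
qed

text \<open>Obstruction theory in its simplest form. Each cell \<open>(a, J)\<close> is assigned a region \<open>X a J\<close> that is
connected enough for the dimension of the cell and contains the regions of its facets; then a map
prescribed on \<open>D\<close> extends over all cells so that each cell stays in its region. A cell of largest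
dimension is removed first: it meets all others, and \<open>D\<close>, in its boundary only, so a map on
the rest can be extended over it by filling one sphere.\<close>

lemma carrier_extension:
  fixes \<C> :: "((nat \<Rightarrow> int) \<times> nat set) set"
  assumes "finite \<C>"
    and D: "closed D" "continuous_on D f"
    and fin: "\<And>a J. (a, J) \<in> \<C> \<Longrightarrow> finite J"
    and int: "\<And>a J. (a, J) \<in> \<C> \<Longrightarrow> D \<inter> cell a J \<subseteq> cell_boundary a J"
    and fX: "\<And>a J x. (a, J) \<in> \<C> \<Longrightarrow> x \<in> D \<inter> cell a J \<Longrightarrow> f x \<in> X a J"
    and facets: "\<And>a J i b. (a, J) \<in> \<C> \<Longrightarrow> i \<in> J \<Longrightarrow> b \<in> {a, a(i := a i + 1)} \<Longrightarrow>
        cell b (J - {i}) \<subseteq> D \<or> (b, J - {i}) \<in> \<C> \<and> X b (J - {i}) \<subseteq> X a J"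
    and fill: "\<And>a J. (a, J) \<in> \<C> \<Longrightarrow> fills (card J) (X a J)"
  shows "\<exists>g. continuous_on (D \<union> (\<Union>(a, J)\<in>\<C>. cell a J)) g \<and> (\<forall>x\<in>D. g x = f x) \<and>
             (\<forall>(a, J)\<in>\<C>. g ` cell a J \<subseteq> X a J)"
  using \<open>finite \<C>\<close> fin int fX facets fill
proof (induction "card \<C>" arbitrary: \<C>)
  case 0
  then have "\<C> = {}" by simp
  then show ?case using D by (intro exI[of _ f]) simp
next
  case (Suc n)
  note fin = Suc.prems(2) and int = Suc.prems(3) and fX = Suc.prems(4) and facets = Suc.prems(5)
    and fill = Suc.prems(6)
  have ne: "\<C> \<noteq> {}" using Suc.hyps(2) by auto
  have "Max ((card \<circ> snd) ` \<C>) \<in> (card \<circ> snd) ` \<C>"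
    using Suc.prems(1) ne by (intro Max_in) auto
  then obtain c where "Max ((card \<circ> snd) ` \<C>) = (card \<circ> snd) c" and c: "c \<in> \<C>"
    by (rule imageE)
  then have cmax': "(card \<circ> snd) c' \<le> (card \<circ> snd) c" if "c' \<in> \<C>" for c'
    using Suc.prems(1) that by (metis Max_ge finite_imageI imageI)
  obtain a J where aJ: "c = (a, J)" by force
  have cmax: "card K \<le> card J" if "(b, K) \<in> \<C>" for b K using cmax'[OF that] aJ by simp
  have inC: "(a, J) \<in> \<C>" using c aJ by simp
  define \<C>' where "\<C>' = \<C> - {(a, J)}"
  define Y where "Y = D \<union> (\<Union>(b, K)\<in>\<C>'. cell b K)"
  have finC': "finite \<C>'" using Suc.prems(1) unfolding \<C>'_def by simp
  have "\<exists>g. continuous_on Y g \<and> (\<forall>x\<in>D. g x = f x) \<and> (\<forall>(a, J)\<in>\<C>'. g ` cell a J \<subseteq> X a J)"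
    unfolding Y_def
  proof (rule Suc.hyps(1))
    show "n = card \<C>'" using Suc.hyps(2) Suc.prems(1) inC unfolding \<C>'_def by simp
    show "finite \<C>'" by (rule finC')
    show "finite K" if "(b, K) \<in> \<C>'" for b K using that fin unfolding \<C>'_def by blast
    show "D \<inter> cell b K \<subseteq> cell_boundary b K" if "(b, K) \<in> \<C>'" for b K
      using that int unfolding \<C>'_def by blast
    show "f x \<in> X b K" if "(b, K) \<in> \<C>'" "x \<in> D \<inter> cell b K" for b K x
      using that fX unfolding \<C>'_def by blast
    show "fills (card K) (X b K)" if "(b, K) \<in> \<C>'" for b K
      using that fill unfolding \<C>'_def by blast
    fix b K i b'
    assume bK: "(b, K) \<in> \<C>'" "i \<in> K" "b' \<in> {b, b(i := b i + 1)}"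
    have "(b, K) \<in> \<C>" using bK unfolding \<C>'_def by simp
    then have "card (K - {i}) < card J"
      using cmax fin bK(2) by (meson card_Diff1_less order_less_le_trans)
    then have "K - {i} \<noteq> J" by auto
    then show "cell b' (K - {i}) \<subseteq> D \<or> (b', K - {i}) \<in> \<C>' \<and> X b' (K - {i}) \<subseteq> X b K"
      using facets[of b K i b'] bK unfolding \<C>'_def by blast
  qed
  then obtain g where g: "continuous_on Y g" "\<And>x. x \<in> D \<Longrightarrow> g x = f x"
    and gX': "\<forall>(b, K)\<in>\<C>'. g ` cell b K \<subseteq> X b K" by blast
  have gX: "g ` cell b K \<subseteq> X b K" if "(b, K) \<in> \<C>'" for b K
    using bspec[OF gX' that] by simp
  have closedY: "closed Y" unfolding Y_def
    using D(1) finC' by (intro closed_Un closed_UN) (auto simp: closed_cell)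
  \<comment> \<open>Maximality of the dimension of the removed cell enters here: no other cell can
    contain one of its interior points.\<close>
  have meet: "Y \<inter> cell a J \<subseteq> cell_boundary a J"
  proof
    fix x assume x: "x \<in> Y \<inter> cell a J"
    show "x \<in> cell_boundary a J"
    proof (rule ccontr)
      assume nb: "x \<notin> cell_boundary a J"
      then have "x \<notin> D" using int[OF inC] x by blast
      then obtain b K where bK: "(b, K) \<in> \<C>'" "x \<in> cell b K" using x unfolding Y_def by auto
      then have "(b, K) \<in> \<C>" unfolding \<C>'_def by simp
      then have "a = b \<and> J = K"
        using cell_interiors_disjoint[OF _ nb bK(2)] x fin inC cmax by blast
      then show False using bK unfolding \<C>'_def by simp
    qed
  qed
  have bdY: "x \<in> Y \<and> g x \<in> X a J" if x: "x \<in> cell_boundary a J" for x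
  proof -
    obtain i b where ib: "i \<in> J" "b \<in> {a, a(i := a i + 1)}" "x \<in> cell b (J - {i})"
      using cell_facets[OF x] .
    have "x \<in> cell a J" using x unfolding cell_boundary_def by simp
    from facets[OF inC ib(1,2)] show ?thesis
    proof
      assume "cell b (J - {i}) \<subseteq> D"
      then have "x \<in> D" using ib by blast
      then show ?thesis using g(2) fX[OF inC] \<open>x \<in> cell a J\<close> unfolding Y_def by auto
    next
      assume *: "(b, J - {i}) \<in> \<C> \<and> X b (J - {i}) \<subseteq> X a J"
      have "(b, J - {i}) \<in> \<C>'" using * ib(1) unfolding \<C>'_def by auto
      then show ?thesis using gX[of b "J - {i}"] * ib(3) unfolding Y_def by blast
    qed
  qed
  obtain g1 where g1: "continuous_on (cell a J) g1" "g1 ` cell a J \<subseteq> X a J"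
    "\<And>x. x \<in> cell_boundary a J \<Longrightarrow> g1 x = g x"
    using fills_cell[OF fill[OF inC] fin[OF inC], of a g] continuous_on_subset[OF g(1)] bdY by blast
  define G where "G x = (if x \<in> Y then g x else g1 x)" for x
  have Gc: "G x = g1 x" if "x \<in> cell a J" for x
    using that meet g1(3) unfolding G_def by auto
  have "continuous_on (Y \<union> cell a J) (\<lambda>x. if x \<in> Y then g x else g1 x)"
    by (rule continuous_on_cases) (use closedY closed_cell g(1) g1 meet in auto)
  then have "continuous_on (Y \<union> cell a J) G" by (simp add: G_def[abs_def])
  moreover have "Y \<union> cell a J = D \<union> (\<Union>(a, J)\<in>\<C>. cell a J)"
    using inC unfolding Y_def \<C>'_def by auto
  moreover have "G x = f x" if "x \<in> D" for x using that g(2) unfolding G_def Y_def by simp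
  moreover have "G ` cell b K \<subseteq> X b K" if bK: "(b, K) \<in> \<C>" for b K
  proof (cases "(b, K) = (a, J)")
    case True
    then show ?thesis using g1(2) Gc by auto
  next
    case False
    then have bK': "(b, K) \<in> \<C>'" using bK unfolding \<C>'_def by simp
    then have "cell b K \<subseteq> Y" unfolding Y_def by blast
    then show ?thesis using gX[OF bK'] unfolding G_def by auto
  qed
  ultimately show ?case by (intro exI[of _ G]) (simp add: case_prod_unfold)
qed

text \<open>The metric on sequences is a sum with weights \<open>(1/2)^n\<close>, whose total is \<open>2\<close>.\<close>

lemma dist_fun_le_coordinatewise:
  fixes x y :: "nat \<Rightarrow> real"
  assumes "\<And>i. \<bar>x i - y i\<bar> \<le> e"
  shows "dist x y \<le> 2 * e"
proof -
  have e: "0 \<le> e" using assms[of 0] by linarith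
  have s: "(\<lambda>n. (1/2) ^ n * e) sums (2 * e)"
    using sums_mult2[OF geometric_sums[of "1/2::real"], of e] by simp
  have "dist x y = (\<Sum>n. (1/2)^n * min (dist (x (from_nat n)) (y (from_nat n))) 1)"
    by (rule dist_fun_def)
  also have "\<dots> \<le> (\<Sum>n. (1/2) ^ n * e)"
  proof (rule suminf_le)
    show "summable (\<lambda>n. (1/2::real) ^ n * e)" using s by (simp add: sums_iff)
    show "(1/2)^n * min (dist (x (from_nat n)) (y (from_nat n))) 1 \<le> (1/2) ^ n * e" for n
      using assms[of "from_nat n"] by (intro mult_left_mono) (auto simp: dist_real_def)
    show "summable (\<lambda>n. (1/2)^n * min (dist (x (from_nat n)) (y (from_nat n))) 1)"
      by (rule summable_comparison_test'[of "\<lambda>n. (1/2)^n"]) (auto simp: summable_geometric_iff)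
  qed
  also have "\<dots> = 2 * e" using s by (simp add: sums_iff)
  finally show ?thesis .
qed

lemma compact_product:
  fixes A :: "nat \<Rightarrow> real set"
  assumes "\<And>i. compact (A i)"
  shows "compact {x. \<forall>i. x i \<in> A i}"
proof -
  have "{x. \<forall>i. x i \<in> A i} = PiE UNIV A" by (auto simp: PiE_def Pi_def)
  moreover have "compactin (product_topology (\<lambda>_. euclidean) UNIV) (PiE UNIV A)"
    using assms by (subst compactin_PiE) auto
  ultimately show ?thesis by (simp add: euclidean_product_topology)
qed

lemma compact_shell: "compact (shell d)"
proof -
  let ?A = "\<lambda>i. if i < d then {-1..1::real} else {0}"
  have "compact {x::nat \<Rightarrow> real. \<forall>i. x i \<in> ?A i}" by (rule compact_product) auto
  moreover have "closed {x. sup_norm d x = 1}"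
    using gauge_normD(1)[OF gauge_norm_sup] by (intro closed_Collect_eq continuous_intros) auto
  moreover have "shell d = {x. \<forall>i. x i \<in> ?A i} \<inter> {x. sup_norm d x = 1}"
    by (auto simp: coord_space_def sup_norm_eq_1_iff abs_le_iff split: if_splits)
  ultimately show ?thesis by (simp add: compact_Int_closed)
qed

section \<open>Connectedness of a union of two open sets\<close>

text \<open>The gluing principle: if \<open>U\<close> and \<open>V\<close> are open and \<open>k\<close>-connected and \<open>U \<inter> V\<close> is \<open>(k-1)\<close>-connected, then
the union is \<open>k\<close>-connected (here \<open>d = k + 1\<close>). Cut the boundary of the \<open>d\<close>-cube into a grid so fine that each
grid cell is mapped into \<open>U\<close> or into \<open>V\<close>. It suffices to contract the map to a point \<open>p\<close> of \<open>U \<inter> V\<close>,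
and the homotopy is built cell by cell on the prism over the grid. Cells of dimension below
\<open>d - 1\<close> that are mapped into both sets are moved inside \<open>U \<inter> V\<close>, all others inside \<open>U\<close> or \<open>V\<close>;
the prism over a cell has one dimension more than the cell, and this is what the connectedness
assumptions allow.\<close>

lemma fills_union:
  fixes U V X :: "'b::topological_space set"
  assumes U: "openin (top_of_set X) U" and V: "openin (top_of_set X) V" and UV: "U \<union> V = X"
    and fU: "\<And>j. j \<le> d \<Longrightarrow> fills j U" and fV: "\<And>j. j \<le> d \<Longrightarrow> fills j V"
    and fUV: "\<And>j. j < d \<Longrightarrow> fills j (U \<inter> V)"
  shows "fills d X"
proof (cases "d = 0")
  case True
  then show ?thesis using fU[of 0] UV by (auto simp: fills_0_iff)
next
  case False
  then obtain p where p: "p \<in> U" "p \<in> V" using fUV[of 0] by (auto simp: fills_0_iff)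
  show ?thesis
  proof (rule fillsI)
    fix f assume f: "continuous_on (shell d) f" "f ` shell d \<subseteq> X"
    obtain e where e: "0 < e" and small: "\<And>T. T \<subseteq> shell d \<Longrightarrow> diameter T < e \<Longrightarrow> f ` T \<subseteq> U \<or> f ` T \<subseteq> V"
    proof -
      have pre: "\<exists>O'. open O' \<and> shell d \<inter> f -` W = shell d \<inter> O'"
        if oW: "openin (top_of_set X) W" for W
      proof -
        obtain W' where "open W'" "W = X \<inter> W'" using oW unfolding openin_open by blast
        moreover from this have "shell d \<inter> f -` W = shell d \<inter> f -` W'" using f(2) by auto
        moreover obtain O' where "open O'" "O' \<inter> shell d = f -` W' \<inter> shell d"
          using f(1) \<open>open W'\<close> unfolding continuous_on_open_invariant by blast
        ultimately show ?thesis by (intro exI[of _ O']) blast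
      qed
      obtain O1 where O1: "open O1" "shell d \<inter> f -` U = shell d \<inter> O1" using pre[OF U] by blast
      obtain O2 where O2: "open O2" "shell d \<inter> f -` V = shell d \<inter> O2" using pre[OF V] by blast
      have cov: "shell d \<subseteq> \<Union>{O1, O2}"
      proof
        fix x assume x: "x \<in> shell d"
        then have "f x \<in> U \<or> f x \<in> V" using f(2) UV by blast
        then have "x \<in> shell d \<inter> f -` U \<or> x \<in> shell d \<inter> f -` V" using x by blast
        then show "x \<in> \<Union>{O1, O2}" unfolding O1 O2 by blast
      qed
      obtain e where "0 < e" and e: "\<And>T. T \<subseteq> shell d \<Longrightarrow> diameter T < e \<Longrightarrow> \<exists>B\<in>{O1, O2}. T \<subseteq> B"
        using Lebesgue_number_lemma[OF compact_shell _ cov] O1(1) O2(1) by blast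
      have "f ` T \<subseteq> U \<or> f ` T \<subseteq> V" if T: "T \<subseteq> shell d" "diameter T < e" for T
      proof -
        have "T \<subseteq> shell d \<inter> O1 \<or> T \<subseteq> shell d \<inter> O2" using e[OF T] T(1) by blast
        then show ?thesis unfolding O1(2)[symmetric] O2(2)[symmetric] by blast
      qed
      then show thesis using that \<open>0 < e\<close> by blast
    qed
    \<comment> \<open>After scaling, grid cells have side 2 / n in every coordinate, hence diameter
      at most 4 / n in the metric of the sequence space.\<close>
    obtain n :: nat where n: "4 / e < real n" using reals_Archimedean2 by blast
    have n0: "0 < n"
    proof (rule ccontr)
      assume "\<not> 0 < n"
      moreover have "0 < 4 / e" using e by simp
      ultimately show False using n by simp
    qed
    have n0r: "0 < real n" using n0 by simp
    define \<phi> where "\<phi> y = (\<lambda>i. if i < d then 2 * y i / real n - 1 else 0)" for y :: "nat \<Rightarrow> real"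
    have c\<phi>: "continuous_on S \<phi>" for S unfolding \<phi>_def
    proof (rule continuous_on_coordinatewise_then_product)
      fix i show "continuous_on S (\<lambda>y. if i < d then 2 * y i / real n - 1 else 0)"
        using n0 by (cases "i < d") (auto intro!: continuous_intros continuous_on_coord)
    qed
    \<comment> \<open>The boundary of the box [0,n]^d, times [0,1] in coordinate d: the domain of
      the homotopy. The map to be contracted sits at height 0, the constant p at height 1.\<close>
    define W where "W = {y::nat \<Rightarrow> real. (\<forall>i<d. 0 \<le> y i \<and> y i \<le> real n) \<and> (\<exists>i<d. y i = 0 \<or> y i = real n) \<and>
        0 \<le> y d \<and> y d \<le> 1 \<and> (\<forall>i>d. y i = 0)}"
    have \<phi>W: "\<phi> y \<in> shell d" if y: "y \<in> W" for y
    proof -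
      have "\<bar>2 * y i / real n - 1\<bar> \<le> 1" if "i < d" for i
      proof -
        have "0 \<le> y i" "y i \<le> real n" using y that unfolding W_def by auto
        then have "0 \<le> 2 * y i / real n" "2 * y i / real n \<le> 2" using n0r by (auto simp: field_simps)
        then show ?thesis by linarith
      qed
      moreover obtain i where "i < d" "y i = 0 \<or> y i = real n" using y unfolding W_def by auto
      then have "\<bar>2 * y i / real n - 1\<bar> = 1" using n0 by auto
      ultimately show ?thesis using \<open>i < d\<close> by (auto simp: \<phi>_def coord_space_def sup_norm_eq_1_iff)
    qed
    have closedW: "closed W"
    proof -
      have "W = (\<Inter>i\<in>{..<d}. {y. 0 \<le> y i \<and> y i \<le> real n}) \<inter> (\<Union>i\<in>{..<d}. {y. y i = 0 \<or> y i = real n}) \<inter>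
        {y. 0 \<le> y d \<and> y d \<le> 1} \<inter> (\<Inter>i\<in>{d<..}. {y. y i = 0})"
        unfolding W_def by auto
      then show ?thesis
        by (auto intro!: closed_Int closed_INT closed_UN closed_Collect_conj closed_Collect_disj
          closed_Collect_le closed_Collect_eq continuous_on_coord continuous_intros)
    qed
    define D where "D = W \<inter> {y. y d = 0 \<or> y d = 1}"
    have closedD: "closed D" unfolding D_def
      by (intro closed_Int closedW closed_Collect_disj closed_Collect_eq continuous_on_coord continuous_intros)
    define f0 where "f0 y = (if y d = 0 then f (\<phi> y) else p)" for y
    have cf0: "continuous_on D f0"
    proof -
      let ?A = "W \<inter> {y. y d = 0}" and ?B = "W \<inter> {y. y d = 1}"
      have cl: "closed ?A" "closed ?B"
        by (intro closed_Int closedW closed_Collect_eq continuous_on_coord continuous_intros)+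
      have "continuous_on ?A (\<lambda>y. f (\<phi> y))"
        by (rule continuous_on_compose2[OF f(1) c\<phi>]) (use \<phi>W in auto)
      then have "continuous_on (?A \<union> ?B) (\<lambda>y. if y d = 0 then f (\<phi> y) else p)"
        by (intro continuous_on_cases cl) auto
      moreover have "?A \<union> ?B = D" unfolding D_def by auto
      ultimately show ?thesis unfolding f0_def[abs_def] by (simp only:)
    qed
    \<comment> \<open>The prisms over the grid cells of the boundary: every cell is free in the time
      coordinate d and has some spatial coordinate frozen at 0 or n.\<close>
    define \<C> where "\<C> = {(a :: nat \<Rightarrow> int, J). d \<in> J \<and> J \<subseteq> {..d} \<and> a d = 0 \<and> (\<forall>i>d. a i = 0) \<and>
        (\<forall>i<d. 0 \<le> a i \<and> a i + (if i \<in> J then 1 else 0) \<le> int n) \<and>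
        (\<exists>i<d. i \<notin> J \<and> (a i = 0 \<or> a i = int n))}"
    have fin\<C>: "finite \<C>"
    proof (rule finite_subset)
      let ?F = "{a :: nat \<Rightarrow> int. \<forall>i. (i \<in> {..d} \<longrightarrow> a i \<in> {0..int n}) \<and> (i \<notin> {..d} \<longrightarrow> a i = 0)}"
      show "finite (?F \<times> Pow {..d})"
        by (intro finite_cartesian_product finite_set_of_finite_funs) auto
      show "\<C> \<subseteq> ?F \<times> Pow {..d}"
      proof (rule subrelI)
        fix a J assume aJ: "(a, J) \<in> \<C>"
        have "a i \<in> {0..int n}" if "i \<le> d" for i
        proof (cases "i = d")
          case True
          then show ?thesis using aJ unfolding \<C>_def by simp
        next
          case False
          then have "i < d" using that by simp
          then have "0 \<le> a i \<and> a i + (if i \<in> J then 1 else 0) \<le> int n" using aJ unfolding \<C>_def by blast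
          then show ?thesis by (auto split: if_splits)
        qed
        then show "(a, J) \<in> ?F \<times> Pow {..d}" using aJ unfolding \<C>_def by auto
      qed
    qed
    have cellW: "cell a J \<subseteq> W" if aJ: "(a, J) \<in> \<C>" for a J
    proof
      fix y assume y: "y \<in> cell a J"
      note yc = y[unfolded cell_def, THEN CollectD, rule_format]
      have "0 \<le> y i \<and> y i \<le> real n" if "i < d" for i
      proof -
        have "0 \<le> a i" "a i + (if i \<in> J then 1 else 0) \<le> int n" using aJ that unfolding \<C>_def by auto
        then have "0 \<le> real_of_int (a i)" "real_of_int (a i) + (if i \<in> J then 1 else 0) \<le> real n"
          by (simp, smt (verit) of_int_1 of_int_add of_int_le_iff of_int_of_nat_eq of_int_0)
        then show ?thesis using yc[of i] by (auto split: if_splits)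
      qed
      moreover obtain i where i: "i < d" "i \<notin> J" "a i = 0 \<or> a i = int n" using aJ unfolding \<C>_def by auto
      then have "y i = 0 \<or> y i = real n" using yc[of i] by auto
      moreover have "0 \<le> y d \<and> y d \<le> 1" using yc[of d] aJ unfolding \<C>_def by auto
      moreover have "y i = 0" if "i > d" for i
      proof -
        have "i \<notin> J" "a i = 0" using aJ that unfolding \<C>_def by auto
        then show ?thesis using yc[of i] by simp
      qed
      ultimately show "y \<in> W" using i(1) unfolding W_def by blast
    qed
    have Wcell: "\<exists>a J. (a, J) \<in> \<C> \<and> y \<in> cell a J" if y: "y \<in> W" for y
    proof -
      define J where "J = insert d {i. i < d \<and> y i \<notin> \<int>}"
      define a where "a i = (if i < d then \<lfloor>y i\<rfloor> else 0)" for i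
      obtain i where i: "i < d" "y i = 0 \<or> y i = real n" using y unfolding W_def by auto
      have b: "0 \<le> a i \<and> a i + (if i \<in> J then 1 else 0) \<le> int n" if "i < d" for i
      proof -
        have yi: "0 \<le> y i" "y i \<le> real n" using y that unfolding W_def by auto
        have "\<lfloor>y i\<rfloor> + (if i \<in> J then 1 else 0) \<le> int n"
        proof (cases "i \<in> J")
          case True
          then have "y i \<noteq> real n" using that unfolding J_def by auto
          then show ?thesis using yi True by (simp add: floor_less_iff int_less_real_le flip: zless_iff_Suc_zadd) linarith
        next
          case False
          then show ?thesis using yi by (simp add: floor_le_iff)
        qed
        then show ?thesis using yi that unfolding a_def by simp
      qed
      have "(a, J) \<in> \<C>" unfolding \<C>_def
      proof (intro CollectI case_prodI conjI)
        show "\<exists>i<d. i \<notin> J \<and> (a i = 0 \<or> a i = int n)"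
          using i by (intro exI[of _ i]) (auto simp: J_def a_def)
        show "\<forall>i<d. 0 \<le> a i \<and> a i + (if i \<in> J then 1 else 0) \<le> int n" using b by blast
      qed (auto simp: J_def a_def)
      moreover have "y \<in> cell a J" unfolding cell_def
      proof (intro CollectI allI)
        fix i
        show "if i \<in> J then real_of_int (a i) \<le> y i \<and> y i \<le> real_of_int (a i) + 1 else y i = real_of_int (a i)"
        proof (cases i d rule: linorder_cases)
          case less
          then show ?thesis by (auto simp: a_def J_def elim: Ints_cases)
        next
          case equal
          then show ?thesis using y by (auto simp: a_def J_def W_def)
        next
          case greater
          then show ?thesis using y by (auto simp: a_def J_def W_def)
        qed
      qed
      ultimately show ?thesis by blast
    qed
    define P where "P a J = f ` \<phi> ` cell a J" for a J
    have PX: "P a J \<subseteq> U \<or> P a J \<subseteq> V" if aJ: "(a, J) \<in> \<C>" for a J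
    proof -
      have "dist x y \<le> 4 / real n" if xy: "x \<in> \<phi> ` cell a J" "y \<in> \<phi> ` cell a J" for x y
      proof -
        obtain x' y' where x': "x' \<in> cell a J" "x = \<phi> x'" and y': "y' \<in> cell a J" "y = \<phi> y'" using xy by blast
        have "\<bar>x i - y i\<bar> \<le> 2 / real n" for i
        proof (cases "i < d")
          case True
          have "\<bar>x' i - y' i\<bar> \<le> 1"
            using x'(1)[unfolded cell_def, THEN CollectD, rule_format, of i]
              y'(1)[unfolded cell_def, THEN CollectD, rule_format, of i] by (auto split: if_splits)
          moreover have "x i - y i = (2 / real n) * (x' i - y' i)"
            unfolding x' y' \<phi>_def using True by (simp add: diff_divide_distrib right_diff_distrib)
          moreover from this have "\<bar>x i - y i\<bar> = (2 / real n) * \<bar>x' i - y' i\<bar>"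
            using n0r by (simp only: abs_mult) simp
          ultimately show ?thesis using n0r mult_left_mono[of "\<bar>x' i - y' i\<bar>" 1 "2 / real n"] by simp
        next
          case False
          then show ?thesis unfolding x' y' \<phi>_def by simp
        qed
        from dist_fun_le_coordinatewise[of x y, OF this] show ?thesis by simp
      qed
      then have "diameter (\<phi> ` cell a J) \<le> 4 / real n"
        unfolding diameter_def using n0r by (auto intro!: cSUP_least)
      also have "\<dots> < e" using n e n0r by (simp add: field_simps)
      finally show ?thesis unfolding P_def
        using small[of "\<phi> ` cell a J"] cellW[OF aJ] \<phi>W by blast
    qed
    \<comment> \<open>Prisms of top dimension d are sent to one of the two sets even when the base
      lies in both, because spheres of dimension d - 1 need not be fillable in the
      intersection.\<close>
    define Y where "Y a J = (if card J < d \<and> P a J \<subseteq> U \<inter> V then U \<inter> V else if P a J \<subseteq> U then U else V)" for a J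
    have cardJ: "card J \<le> d" "finite J" if aJ: "(a, J) \<in> \<C>" for a J
    proof -
      obtain i where "i < d" "i \<notin> J" and J: "J \<subseteq> {..d}" using aJ unfolding \<C>_def by auto
      then have "J \<subseteq> {..d} - {i}" by auto
      then have "card J \<le> card ({..d} - {i})" by (intro card_mono) auto
      then show "card J \<le> d" using \<open>i < d\<close> by simp
      show "finite J" using J finite_subset by blast
    qed
    have "\<exists>g. continuous_on (D \<union> (\<Union>(a, J)\<in>\<C>. cell a J)) g \<and> (\<forall>x\<in>D. g x = f0 x) \<and>
             (\<forall>(a, J)\<in>\<C>. g ` cell a J \<subseteq> Y a J)"
    proof (rule carrier_extension[OF fin\<C> closedD cf0])
      fix a J assume aJ: "(a, J) \<in> \<C>"
      have dJ: "d \<in> J" "a d = 0" using aJ unfolding \<C>_def by auto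
      show "finite J" by (rule cardJ(2)[OF aJ])
      show "D \<inter> cell a J \<subseteq> cell_boundary a J"
        using dJ unfolding D_def cell_boundary_def by (auto intro!: bexI[of _ d])
      show "fills (card J) (Y a J)"
        using cardJ(1)[OF aJ] fU fV fUV unfolding Y_def by simp
      show "f0 x \<in> Y a J" if "x \<in> D \<inter> cell a J" for x
      proof -
        have "f (\<phi> x) \<in> P a J" using that unfolding P_def by blast
        then have "f (\<phi> x) \<in> Y a J" using PX[OF aJ] unfolding Y_def by auto
        moreover have "p \<in> Y a J" using p unfolding Y_def by auto
        ultimately show ?thesis unfolding f0_def by simp
      qed
      fix i b assume i: "i \<in> J" and b: "b \<in> {a, a(i := a i + 1)}"
      show "cell b (J - {i}) \<subseteq> D \<or> (b, J - {i}) \<in> \<C> \<and> Y b (J - {i}) \<subseteq> Y a J"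
      proof (cases "i = d")
        case True
        have "y d = 0 \<or> y d = 1" if "y \<in> cell b (J - {i})" for y
          using that[unfolded cell_def, THEN CollectD, rule_format, of d] b dJ True by auto
        then show ?thesis using facet_subset_cell[OF i b] cellW[OF aJ] unfolding D_def by blast
      next
        case False
        then have id: "i < d" using i aJ unfolding \<C>_def by auto
        obtain k where k: "k < d" "k \<notin> J" "a k = 0 \<or> a k = int n" using aJ unfolding \<C>_def by auto
        have ki: "k \<noteq> i" using k i by blast
        have "(b, J - {i}) \<in> \<C>" unfolding \<C>_def
        proof (intro CollectI case_prodI conjI)
          show "\<exists>k<d. k \<notin> J - {i} \<and> (b k = 0 \<or> b k = int n)"
            using k ki b by (intro exI[of _ k]) auto
          show "\<forall>l<d. 0 \<le> b l \<and> b l + (if l \<in> J - {i} then 1 else 0) \<le> int n"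
          proof (intro allI impI)
            fix l assume "l < d"
            then have "0 \<le> a l \<and> a l + (if l \<in> J then 1 else 0) \<le> int n" using aJ unfolding \<C>_def by blast
            then show "0 \<le> b l \<and> b l + (if l \<in> J - {i} then 1 else 0) \<le> int n"
              using b i by (cases "l = i") auto
          qed
        qed (use aJ b id in \<open>auto simp: \<C>_def\<close>)
        moreover have "card (J - {i}) < d"
          using cardJ[OF aJ] i by (meson card_Diff1_less order_less_le_trans)
        moreover have "P b (J - {i}) \<subseteq> P a J"
          unfolding P_def using facet_subset_cell[OF i b] by (intro image_mono)
        ultimately show ?thesis using PX[OF aJ] unfolding Y_def by auto
      qed
    qed
    then obtain g where g: "continuous_on (D \<union> (\<Union>(a, J)\<in>\<C>. cell a J)) g" "\<And>x. x \<in> D \<Longrightarrow> g x = f0 x"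
      and gY: "\<forall>(a, J)\<in>\<C>. g ` cell a J \<subseteq> Y a J" by blast
    have "D \<union> (\<Union>(a, J)\<in>\<C>. cell a J) = W"
    proof
      show "D \<union> (\<Union>(a, J)\<in>\<C>. cell a J) \<subseteq> W" using cellW unfolding D_def by auto
      show "W \<subseteq> D \<union> (\<Union>(a, J)\<in>\<C>. cell a J)" using Wcell by fast
    qed
    then have cg: "continuous_on W g" using g(1) by simp
    have gX: "g y \<in> X" if yW: "y \<in> W" for y
    proof -
      obtain a J where aJ: "(a, J) \<in> \<C>" "y \<in> cell a J" using Wcell[OF yW] by blast
      then have "g y \<in> Y a J" using bspec[OF gY aJ(1)] by auto
      then show ?thesis using UV unfolding Y_def by (auto split: if_splits)
    qed
    \<comment> \<open>Inverse of the scaling map at height t.\<close>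
    define \<psi> where "\<psi> t x = (\<lambda>i. if i < d then real n * (x i + 1) / 2 else if i = d then t else 0)"
      for t :: real and x :: "nat \<Rightarrow> real"
    have \<psi>W: "\<psi> t x \<in> W" if "t \<in> {0..1}" "x \<in> shell d" for t x
    proof -
      have x: "\<And>i. i < d \<Longrightarrow> \<bar>x i\<bar> \<le> 1" "\<exists>i<d. \<bar>x i\<bar> = 1"
        using that(2) by (auto simp: sup_norm_eq_1_iff)
      have "0 \<le> real n * (x i + 1) / 2 \<and> real n * (x i + 1) / 2 \<le> real n" if "i < d" for i
      proof -
        have "0 \<le> x i + 1" "x i + 1 \<le> 2" using x(1)[OF that] by auto
        then show ?thesis using mult_left_mono[of "x i + 1" 2 "real n"] by auto
      qed
      moreover obtain i where "i < d" "\<bar>x i\<bar> = 1" using x(2) by blast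
      then have "real n * (x i + 1) / 2 = 0 \<or> real n * (x i + 1) / 2 = real n" by (auto simp: abs_if split: if_splits)
      ultimately show ?thesis using that(1) \<open>i < d\<close> unfolding W_def \<psi>_def by auto
    qed
    have "continuous_on ({0..1} \<times> shell d) (\<lambda>q. \<psi> (fst q) (snd q))"
      unfolding \<psi>_def
    proof (rule continuous_on_coordinatewise_then_product)
      fix i
      have "continuous_on ({0..1} \<times> shell d) (\<lambda>q::real \<times> (nat \<Rightarrow> real). snd q i)"
        by (rule continuous_on_product_then_coordinatewise) (intro continuous_intros)
      then show "continuous_on ({0..1} \<times> shell d) (\<lambda>q::real \<times> (nat \<Rightarrow> real).
          if i < d then real n * (snd q i + 1) / 2 else if i = d then fst q else 0)"
        by (cases i d rule: linorder_cases) (auto intro!: continuous_intros)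
    qed
    then have "continuous_on ({0..1} \<times> shell d) (g \<circ> (\<lambda>q. \<psi> (fst q) (snd q)))"
      by (intro continuous_on_compose continuous_on_subset[OF cg]) (use \<psi>W in auto)
    then have hom: "continuous_on ({0..1} \<times> shell d) (\<lambda>(t, x). g (\<psi> t x))"
      by (simp add: comp_def case_prod_unfold)
    obtain g' where g': "continuous_on (cube d) g'" "g' ` cube d \<subseteq> X"
        "\<And>x. x \<in> shell d \<Longrightarrow> g' x = g (\<psi> 0 x)"
    proof (rule fills_homotopy[OF hom, of X "\<lambda>_. p"])
      show "g (\<psi> t x) \<in> X" if "t \<in> {0..1}" "x \<in> shell d" for t x using gX[OF \<psi>W[OF that]] .
      show "(\<lambda>_. p) ` cube d \<subseteq> X" using p UV by auto
      show "g (\<psi> 1 x) = p" if "x \<in> shell d" for x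
      proof -
        have "\<psi> 1 x \<in> D" using \<psi>W[of 1 x] that unfolding D_def by (simp add: \<psi>_def)
        then show ?thesis using g(2) by (simp add: f0_def \<psi>_def)
      qed
    qed auto
    have "\<forall>x\<in>shell d. g' x = f x"
    proof
      fix x assume x: "x \<in> shell d"
      have D0: "\<psi> 0 x \<in> D" using \<psi>W[of 0 x] x unfolding D_def by (simp add: \<psi>_def)
      have "\<phi> (\<psi> 0 x) = x"
        using x n0 by (auto simp: \<phi>_def \<psi>_def coord_space_def fun_eq_iff)
      then show "g' x = f x" using g'(3)[OF x] g(2)[OF D0] by (simp add: f0_def \<psi>_def)
    qed
    with g'(1,2) show "\<exists>g. continuous_on (cube d) g \<and> g ` cube d \<subseteq> X \<and> (\<forall>x\<in>shell d. g x = f x)"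
      by blast
  qed
qed

section \<open>Deletion and link of a vertex in a simplicial complex\<close>

definition realization :: "'v set set \<Rightarrow> ('v \<Rightarrow> real) set" where
  "realization K = {x. (\<forall>v. 0 \<le> x v) \<and> {v. x v \<noteq> 0} \<in> K \<and> (\<Sum>v | x v \<noteq> 0. x v) = 1}"

lemma geometric_realization_eq: "geometric_realization K = top_of_set (realization K)"
  by (simp add: geometric_realization_def realization_def euclidean_product_topology)

definition simplicial_complex :: "'v set \<Rightarrow> 'v set set \<Rightarrow> bool" where
  "simplicial_complex E K \<longleftrightarrow> finite E \<and> K \<subseteq> Pow E \<and> (\<forall>\<sigma>\<in>K. \<forall>\<tau>. \<tau> \<subseteq> \<sigma> \<longrightarrow> \<tau> \<in> K)"

lemma simplicial_complexD:
  assumes "simplicial_complex E K"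
  shows "finite E" "\<sigma> \<in> K \<Longrightarrow> \<sigma> \<subseteq> E" "\<sigma> \<in> K \<Longrightarrow> \<tau> \<subseteq> \<sigma> \<Longrightarrow> \<tau> \<in> K"
  using assms unfolding simplicial_complex_def by blast+

lemma realization_iff:
  assumes "simplicial_complex E K"
  shows "x \<in> realization K \<longleftrightarrow> (\<forall>v. 0 \<le> x v) \<and> {v. x v \<noteq> 0} \<in> K \<and> (\<Sum>v\<in>E. x v) = 1"
proof -
  have "(\<Sum>v | x v \<noteq> 0. x v) = (\<Sum>v\<in>E. x v)" if "{v. x v \<noteq> 0} \<in> K"
    using simplicial_complexD(1,2)[OF assms] that by (intro sum.mono_neutral_left) auto
  then show ?thesis unfolding realization_def by auto
qed

abbreviation vertex_point :: "'v \<Rightarrow> 'v \<Rightarrow> real" where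
  "vertex_point v \<equiv> (\<lambda>w. if w = v then 1 else 0)"

lemma vertex_point_in_realization:
  assumes "{v} \<in> K" shows "vertex_point v \<in> realization K"
proof -
  have "{w. vertex_point v w \<noteq> 0} = {v}" by auto
  then show ?thesis using assms by (simp add: realization_def)
qed

lemma segment_in_realization:
  assumes K: "simplicial_complex E K" and x: "x \<in> realization K" and y: "y \<in> realization K"
    and t: "t \<in> {0..1}" and xy: "{v. x v \<noteq> 0} \<union> {v. y v \<noteq> 0} \<in> K"
  shows "(\<lambda>v. (1 - t) * x v + t * y v) \<in> realization K"
proof -
  have "{v. (1 - t) * x v + t * y v \<noteq> 0} \<subseteq> {v. x v \<noteq> 0} \<union> {v. y v \<noteq> 0}" by auto
  then have "{v. (1 - t) * x v + t * y v \<noteq> 0} \<in> K" using simplicial_complexD(3)[OF K xy] by blast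
  moreover have "(\<Sum>v\<in>E. (1 - t) * x v + t * y v) = 1"
    using x y unfolding realization_iff[OF K] by (simp add: sum.distrib flip: sum_distrib_left)
  ultimately show ?thesis using x y t unfolding realization_iff[OF K] by auto
qed

lemma continuous_on_segment:
  fixes g :: "('v \<Rightarrow> real) \<Rightarrow> 'v \<Rightarrow> real"
  assumes "continuous_on S g"
  shows "continuous_on ({0..1} \<times> S) (\<lambda>(t::real, x) v. (1 - t) * x v + t * g x v)"
  unfolding case_prod_unfold
proof (rule continuous_on_coordinatewise_then_product)
  fix v
  have "continuous_on ({0..1} \<times> S) (\<lambda>q::real \<times> ('v \<Rightarrow> real). snd q v)"
    by (rule continuous_on_product_then_coordinatewise) (intro continuous_intros)
  moreover have "continuous_on ({0..1} \<times> S) (\<lambda>q::real \<times> ('v \<Rightarrow> real). g (snd q) v)"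
    by (rule continuous_on_product_then_coordinatewise, rule continuous_on_compose2[OF assms])
       (auto intro: continuous_intros)
  ultimately show "continuous_on ({0..1} \<times> S)
      (\<lambda>q::real \<times> ('v \<Rightarrow> real). (1 - fst q) * snd q v + fst q * g (snd q) v)"
    by (intro continuous_intros)
qed

lemma fills_starlike:
  assumes "vertex_point v \<in> S"
    and "\<And>x t. x \<in> S \<Longrightarrow> t \<in> {0..1} \<Longrightarrow> (\<lambda>w. (1 - t) * x w + t * vertex_point v w) \<in> S"
  shows "fills d S"
proof (rule fills_contractible[OF assms(1)])
  show "continuous_on ({0..1} \<times> S) (\<lambda>(t, x) w. (1 - t) * x w + t * vertex_point v w)"
    using continuous_on_segment[of S "\<lambda>_. vertex_point v"] by simp
qed (use assms(2) in auto)

lemma fills_realization_cone: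
  assumes K: "simplicial_complex E K" and "{v} \<in> K" and cone: "\<And>\<sigma>. \<sigma> \<in> K \<Longrightarrow> insert v \<sigma> \<in> K"
  shows "fills d (realization K)"
proof (rule fills_starlike[of v])
  show vK: "vertex_point v \<in> realization K" by (rule vertex_point_in_realization[OF assms(2)])
  fix x and t :: real assume x: "x \<in> realization K" and t: "t \<in> {0..1}"
  have "{w. x w \<noteq> 0} \<union> {w. vertex_point v w \<noteq> 0} = insert v {w. x w \<noteq> 0}" by auto
  then show "(\<lambda>w. (1 - t) * x w + t * vertex_point v w) \<in> realization K"
    using cone[of "{w. x w \<noteq> 0}"] x by (intro segment_in_realization[OF K x vK t]) (simp add: realization_def)
qed

lemma fills_open_star:
  assumes K: "simplicial_complex E K" and v: "{v} \<in> K"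
  shows "fills d {x \<in> realization K. 0 < x v}"
proof (rule fills_starlike[of v])
  have vK: "vertex_point v \<in> realization K" by (rule vertex_point_in_realization[OF v])
  then show "vertex_point v \<in> {x \<in> realization K. 0 < x v}" by simp
  fix x and t :: real assume x: "x \<in> {x \<in> realization K. 0 < x v}" and t: "t \<in> {0..1}"
  have eq: "{w. x w \<noteq> 0} \<union> {w. vertex_point v w \<noteq> 0} = {w. x w \<noteq> 0}" using x by auto
  have "(\<lambda>w. (1 - t) * x w + t * vertex_point v w) \<in> realization K"
    by (rule segment_in_realization[OF K _ vK t]) (use x eq in \<open>auto simp: realization_def\<close>)
  moreover have "0 < (1 - t) * x v + t * vertex_point v v"
    using x t by (cases "t = 1") (auto intro: add_pos_nonneg)
  ultimately show "(\<lambda>w. (1 - t) * x w + t * vertex_point v w) \<in> {x \<in> realization K. 0 < x v}" by simp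
qed

definition deletion :: "'v \<Rightarrow> 'v set set \<Rightarrow> 'v set set" where
  "deletion v K = {\<sigma> \<in> K. v \<notin> \<sigma>}"

definition vertex_link :: "'v \<Rightarrow> 'v set set \<Rightarrow> 'v set set" where
  "vertex_link v K = {\<sigma>. v \<notin> \<sigma> \<and> insert v \<sigma> \<in> K}"

definition drop_vertex :: "'v \<Rightarrow> ('v \<Rightarrow> real) \<Rightarrow> 'v \<Rightarrow> real" where
  "drop_vertex v x = (\<lambda>w. if w = v then 0 else x w / (1 - x v))"

lemma continuous_on_drop_vertex:
  assumes "\<And>x. x \<in> S \<Longrightarrow> x v < 1"
  shows "continuous_on S (drop_vertex v)"
  unfolding drop_vertex_def
proof (rule continuous_on_coordinatewise_then_product)
  fix w
  show "continuous_on S (\<lambda>x. if w = v then 0 else x w / (1 - x v))"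
    using assms by (cases "w = v") (force intro!: continuous_intros continuous_on_coord)+
qed

lemma drop_vertex_support:
  assumes "x v < 1" shows "{w. drop_vertex v x w \<noteq> 0} = {w. x w \<noteq> 0} - {v}"
  using assms by (auto simp: drop_vertex_def)

lemma drop_vertex_sum:
  assumes "finite E" "v \<in> E" "(\<Sum>w\<in>E. x w) = 1" "x v < 1"
  shows "(\<Sum>w\<in>E. drop_vertex v x w) = 1"
proof -
  have "(\<Sum>w\<in>E. drop_vertex v x w) = (\<Sum>w\<in>E - {v}. drop_vertex v x w)"
    using assms(1,2) by (simp add: sum.remove[of E v] drop_vertex_def)
  also have "\<dots> = (\<Sum>w\<in>E - {v}. x w / (1 - x v))"
    by (rule sum.cong) (auto simp: drop_vertex_def)
  also have "\<dots> = (\<Sum>w\<in>E - {v}. x w) / (1 - x v)" by (simp add: sum_divide_distrib)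
  also have "(\<Sum>w\<in>E - {v}. x w) = 1 - x v" using assms(1-3) by (simp add: sum.remove[of E v])
  finally show ?thesis using assms(4) by simp
qed

lemma drop_vertex_in_realization:
  assumes K: "simplicial_complex E K" and v: "v \<in> E" and x: "x \<in> realization K" "x v < 1"
  shows "drop_vertex v x \<in> realization K"
proof -
  have "{w. drop_vertex v x w \<noteq> 0} \<in> K"
    unfolding drop_vertex_support[of x v, OF x(2)] using x(1) simplicial_complexD(3)[OF K]
    by (auto simp: realization_def)
  moreover have "0 \<le> drop_vertex v x w" for w
    using x unfolding realization_def drop_vertex_def by auto
  ultimately show ?thesis
    using x drop_vertex_sum[of E v x] simplicial_complexD(1)[OF K] v unfolding realization_iff[OF K] by auto
qed

text \<open>Removing a vertex as a point of the space or as a vertex of the complex makes no difference up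
to homotopy: the complement of the vertex point is pushed radially away from it.\<close>

lemma fills_vertex_complement:
  assumes K: "simplicial_complex E K" and v: "v \<in> E" and fl: "fills d (realization (deletion v K))"
  shows "fills d {x \<in> realization K. x v < 1}"
proof (rule fills_dominated[OF fl, where r = "drop_vertex v" and s = "\<lambda>x. x"
      and h = "\<lambda>t x w. (1 - t) * x w + t * drop_vertex v x w"])
  let ?S = "{x \<in> realization K. x v < 1}"
  show c: "continuous_on ?S (drop_vertex v)" by (rule continuous_on_drop_vertex) simp
  show "continuous_on ({0..1} \<times> ?S) (\<lambda>(t, x) w. (1 - t) * x w + t * drop_vertex v x w)"
    by (rule continuous_on_segment[OF c])
  have inK: "drop_vertex v x \<in> realization K" if "x \<in> ?S" for x
    using that drop_vertex_in_realization[OF K v] by blast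
  show "drop_vertex v ` ?S \<subseteq> realization (deletion v K)"
  proof
    fix y assume "y \<in> drop_vertex v ` ?S"
    then obtain x where "x \<in> ?S" "y = drop_vertex v x" by blast
    then show "y \<in> realization (deletion v K)"
      using inK[of x] drop_vertex_support[of x v] unfolding realization_def deletion_def by auto
  qed
  show "(\<lambda>x. x) ` realization (deletion v K) \<subseteq> ?S"
    unfolding realization_def deletion_def by auto
  fix x assume x: "x \<in> ?S"
  fix t :: real assume t: "t \<in> {0..1}"
  have "{w. x w \<noteq> 0} \<union> {w. drop_vertex v x w \<noteq> 0} = {w. x w \<noteq> 0}"
    using x drop_vertex_support[of x v] by auto
  then have "(\<lambda>w. (1 - t) * x w + t * drop_vertex v x w) \<in> realization K"
    using x inK[OF x] t by (intro segment_in_realization[OF K]) (auto simp: realization_def)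
  moreover have "(1 - t) * x v + t * drop_vertex v x v < 1"
  proof -
    have "0 \<le> x v" "x v < 1" using x by (auto simp: realization_def)
    then have "(1 - t) * x v \<le> 1 * x v" using t by (intro mult_right_mono) auto
    then show ?thesis using \<open>x v < 1\<close> by (simp add: drop_vertex_def)
  qed
  ultimately show "(\<lambda>w. (1 - t) * x w + t * drop_vertex v x w) \<in> ?S" by simp
qed (auto intro: continuous_intros)

text \<open>The punctured open star of \<open>v\<close> is the product of the link of \<open>v\<close> with an open interval; the
link is embedded at height \<open>1/2\<close>.\<close>

lemma fills_punctured_open_star:
  assumes K: "simplicial_complex E K" and v: "v \<in> E" and fl: "fills d (realization (vertex_link v K))"
  shows "fills d {x \<in> realization K. 0 < x v \<and> x v < 1}"
proof -
  define s where "s y = (\<lambda>w. if w = v then 1/2 else y w / 2)" for y :: "'a \<Rightarrow> real"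
  have supp: "{w. s y w \<noteq> 0} = insert v {w. y w \<noteq> 0}" for y by (auto simp: s_def)
  let ?S = "{x \<in> realization K. 0 < x v \<and> x v < 1}"
  let ?L = "vertex_link v K"
  have L: "simplicial_complex E ?L"
    unfolding simplicial_complex_def
  proof (intro conjI ballI allI impI)
    show "finite E" by (rule simplicial_complexD(1)[OF K])
    show "?L \<subseteq> Pow E" using simplicial_complexD(2)[OF K] unfolding vertex_link_def by blast
    fix \<sigma> \<tau> assume "\<sigma> \<in> ?L" "\<tau> \<subseteq> \<sigma>"
    then show "\<tau> \<in> ?L" using simplicial_complexD(3)[OF K, of "insert v \<sigma>" "insert v \<tau>"]
      unfolding vertex_link_def by blast
  qed
  have c: "continuous_on ?S (drop_vertex v)" by (rule continuous_on_drop_vertex) simp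
  have cs: "continuous_on T s" for T unfolding s_def
  proof (rule continuous_on_coordinatewise_then_product)
    fix w show "continuous_on T (\<lambda>y. if w = v then 1 / 2 else y w / 2)"
      by (cases "w = v") (auto intro!: continuous_intros continuous_on_coord)
  qed
  have rL: "drop_vertex v x \<in> realization ?L" if x: "x \<in> ?S" for x
  proof -
    have "drop_vertex v x \<in> realization K" using x drop_vertex_in_realization[OF K v] by blast
    moreover have "insert v ({w. x w \<noteq> 0} - {v}) = {w. x w \<noteq> 0}" using x by auto
    ultimately show ?thesis
      using x drop_vertex_support[of x v] unfolding realization_def vertex_link_def by auto
  qed
  have sS: "s y \<in> ?S" if y: "y \<in> realization ?L" for y
  proof -
    have yv: "y v = 0" using y unfolding realization_def vertex_link_def by auto
    have "(\<Sum>w\<in>E. s y w) = 1/2 + (\<Sum>w\<in>E - {v}. s y w)"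
      using simplicial_complexD(1)[OF K] v by (simp add: sum.remove[of E v] s_def)
    also have "(\<Sum>w\<in>E - {v}. s y w) = (\<Sum>w\<in>E - {v}. y w / 2)"
      by (rule sum.cong) (auto simp: s_def)
    also have "\<dots> = (\<Sum>w\<in>E. y w) / 2"
      using simplicial_complexD(1)[OF K] v yv by (simp add: sum.remove[of E v] sum_divide_distrib)
    also have "(\<Sum>w\<in>E. y w) = 1" using y unfolding realization_iff[OF L] by blast
    finally have "(\<Sum>w\<in>E. s y w) = 1" by simp
    moreover have "insert v {w. y w \<noteq> 0} \<in> K" using y unfolding realization_def vertex_link_def by blast
    moreover have "0 \<le> s y w" for w using y unfolding realization_def s_def by auto
    ultimately have "s y \<in> realization K" using supp unfolding realization_iff[OF K] by auto
    then show ?thesis by (simp add: s_def)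
  qed
  show ?thesis
  proof (rule fills_dominated[OF fl, where r = "drop_vertex v" and s = s
        and h = "\<lambda>t x w. (1 - t) * x w + t * s (drop_vertex v x) w"])
    have "continuous_on ?S (\<lambda>x. s (drop_vertex v x))"
      by (rule continuous_on_compose2[OF cs c]) auto
    then show "continuous_on ({0..1} \<times> ?S) (\<lambda>(t, x) w. (1 - t) * x w + t * s (drop_vertex v x) w)"
      by (rule continuous_on_segment)
    fix x assume x: "x \<in> ?S"
    fix t :: real assume t: "t \<in> {0..1}"
    have sx: "s (drop_vertex v x) \<in> ?S" using sS rL x by blast
    have "{w. x w \<noteq> 0} \<union> {w. s (drop_vertex v x) w \<noteq> 0} = {w. x w \<noteq> 0}"
    proof -
      have "x v < 1" "x v \<noteq> 0" using x by auto
      then show ?thesis unfolding supp drop_vertex_support[of x v, OF \<open>x v < 1\<close>] by blast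
    qed
    then have "(\<lambda>w. (1 - t) * x w + t * s (drop_vertex v x) w) \<in> realization K"
      using x sx t by (intro segment_in_realization[OF K]) (auto simp: realization_def)
    moreover have "0 < (1 - t) * x v + t * s (drop_vertex v x) v"
      "(1 - t) * x v + t * s (drop_vertex v x) v < 1"
    proof -
      have half: "s (drop_vertex v x) v = 1/2" by (simp add: s_def)
      have "x v \<in> {0<..<1}" using x by simp
      then have "0 < (1 - t) * x v + t * (1/2) \<and> (1 - t) * x v + t * (1/2) < 1"
        using convexD_alt[of "{0<..<1::real}" "x v" "1/2" t] t by simp
      then show "0 < (1 - t) * x v + t * s (drop_vertex v x) v"
        "(1 - t) * x v + t * s (drop_vertex v x) v < 1" unfolding half by simp_all
    qed
    ultimately show "(\<lambda>w. (1 - t) * x w + t * s (drop_vertex v x) w) \<in> ?S" by simp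
  qed (use c cs rL sS in auto)
qed

text \<open>The complex is the union of the deletion of \<open>v\<close> and the star of \<open>v\<close>, which is contractible,
and these meet in the link of \<open>v\<close>. In order to have an open cover, the deletion is
thickened to \<open>x v < 1\<close> and the star is taken to be \<open>0 < x v\<close>.\<close>

lemma fills_deletion_link:
  assumes K: "simplicial_complex E K" and v: "{v} \<in> K"
    and del: "\<And>j. j \<le> d \<Longrightarrow> fills j (realization (deletion v K))"
    and lnk: "\<And>j. j < d \<Longrightarrow> fills j (realization (vertex_link v K))"
  shows "fills d (realization K)"
proof -
  let ?U = "{x \<in> realization K. x v < 1}" and ?W = "{x \<in> realization K. 0 < x v}"
  have vE: "v \<in> E" using simplicial_complexD(2)[OF K v] by simp
  show ?thesis
  proof (rule fills_union[of _ ?U ?W])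
    have o: "openin (top_of_set (realization K)) (realization K \<inter> {x. x v < 1})"
      "openin (top_of_set (realization K)) (realization K \<inter> {x. 0 < x v})"
      by (intro openin_open_Int open_Collect_less continuous_on_coord continuous_intros)+
    have e: "realization K \<inter> {x. x v < 1} = ?U" "realization K \<inter> {x. 0 < x v} = ?W" by auto
    show "openin (top_of_set (realization K)) ?U" using o(1) unfolding e .
    show "openin (top_of_set (realization K)) ?W" using o(2) unfolding e .
    show "?U \<union> ?W = realization K" by auto
    show "fills j ?U" if "j \<le> d" for j
      by (rule fills_vertex_complement[OF K vE del[OF that]])
    show "fills j ?W" for j by (rule fills_open_star[OF K v])
    have "?U \<inter> ?W = {x \<in> realization K. 0 < x v \<and> x v < 1}" by auto
    then show "fills j (?U \<inter> ?W)" if "j < d" for j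
      using fills_punctured_open_star[OF K vE lnk[OF that]] by simp
  qed
qed

section \<open>Matching complexes\<close>

definition disjoint_ends :: "('e \<Rightarrow> 'a set) \<Rightarrow> 'e set \<Rightarrow> bool" where
  "disjoint_ends ends M \<longleftrightarrow> pairwise (\<lambda>x y. ends x \<inter> ends y = {}) M"

definition matching_complex :: "('e \<Rightarrow> 'a set) \<Rightarrow> 'e set \<Rightarrow> 'e set set" where
  "matching_complex ends E = {M. M \<subseteq> E \<and> disjoint_ends ends M}"

lemma simplicial_matching_complex:
  "finite E \<Longrightarrow> simplicial_complex E (matching_complex ends E)"
  unfolding simplicial_complex_def matching_complex_def disjoint_ends_def
  by (auto intro: pairwise_subset)

lemma deletion_matching_complex:
  "deletion e (matching_complex ends E) = matching_complex ends (E - {e})"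
  unfolding deletion_def matching_complex_def by auto

lemma vertex_link_matching_complex:
  assumes "e \<in> E"
  shows "vertex_link e (matching_complex ends E) =
    matching_complex ends {e' \<in> E. e' \<noteq> e \<and> ends e' \<inter> ends e = {}}"
  using assms unfolding vertex_link_def matching_complex_def disjoint_ends_def
  by (auto simp: pairwise_insert)

text \<open>Disjoint edges that meet \<open>ends e\<close> do so in different points.\<close>

lemma card_matching_meeting_edge:
  assumes M: "disjoint_ends ends M" and e: "finite (ends e)"
  shows "finite {m \<in> M. ends m \<inter> ends e \<noteq> {}}" "card {m \<in> M. ends m \<inter> ends e \<noteq> {}} \<le> card (ends e)"
proof -
  let ?B = "{m \<in> M. ends m \<inter> ends e \<noteq> {}}"
  have "\<forall>m\<in>?B. \<exists>x. x \<in> ends m \<inter> ends e" by blast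
  then have "\<exists>p. \<forall>m\<in>?B. p m \<in> ends m \<inter> ends e" by (rule bchoice)
  then obtain p where "\<forall>m\<in>?B. p m \<in> ends m \<inter> ends e" by (rule exE)
  then have p: "p m \<in> ends m \<inter> ends e" if "m \<in> ?B" for m using that by (rule bspec)
  have inj: "inj_on p ?B"
  proof (rule inj_onI)
    fix m m' assume m: "m \<in> ?B" "m' \<in> ?B" "p m = p m'"
    then have "p m \<in> ends m \<inter> ends m'" using p[OF m(1)] p[OF m(2)] by simp
    then show "m = m'" using M m(1,2) unfolding disjoint_ends_def pairwise_def by blast
  qed
  have sub: "p ` ?B \<subseteq> ends e" using p by blast
  show "finite ?B" using inj_on_finite[OF inj sub e] .
  show "card ?B \<le> card (ends e)" using card_inj_on_le[OF inj sub e] .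
qed

text \<open>A matching of size \<open>n\<close> makes the matching complex \<open>k\<close>-connected if \<open>2 * k + 3 \<le> n\<close>; here \<open>j = k + 1\<close>.
If some edge \<open>e\<close> avoids some matching of the required size, delete it: the deletion
still has this matching, while the link of \<open>e\<close> is the matching complex of the edges disjoint from
\<open>e\<close>, which loses at most two edges of the matching, one for each end of \<open>e\<close>; since the
connectedness needed of a link is one less, the induction hypothesis covers both. If no
such edge exists, then \<open>E\<close> itself is a matching and the complex is a simplex.\<close>

theorem fills_matching_complex:
  assumes "finite E" and "\<And>e. e \<in> E \<Longrightarrow> finite (ends e) \<and> card (ends e) \<le> 2"
    and "M \<in> matching_complex ends E" and "2 * j + 1 \<le> card M"
  shows "fills j (realization (matching_complex ends E))"
  using assms
proof (induction "card E" arbitrary: E M j rule: less_induct)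
  case less
  let ?K = "matching_complex ends E"
  have K: "simplicial_complex E ?K" by (rule simplicial_matching_complex[OF less.prems(1)])
  show ?case
  proof (cases "\<exists>M'\<in>?K. 2 * j + 1 \<le> card M' \<and> M' \<noteq> E")
    case True
    then obtain M' e where M': "M' \<in> ?K" "2 * j + 1 \<le> card M'" and e: "e \<in> E" "e \<notin> M'"
      unfolding matching_complex_def by blast
    have fM': "finite M'" using M'(1) less.prems(1) finite_subset unfolding matching_complex_def by blast
    let ?L = "{e' \<in> E. e' \<noteq> e \<and> ends e' \<inter> ends e = {}}"
    have smaller: "card (E - {e}) < card E" "card ?L < card E"
      by (rule psubset_card_mono[OF less.prems(1)]; use e in blast)+
    show ?thesis
    proof (rule fills_deletion_link[OF K, of e])
      show "{e} \<in> ?K" using e unfolding matching_complex_def disjoint_ends_def by simp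
      show "fills i (realization (deletion e ?K))" if "i \<le> j" for i
        unfolding deletion_matching_complex
      proof (rule less.hyps[OF smaller(1)])
        show "M' \<in> matching_complex ends (E - {e})" using M'(1) e(2) unfolding matching_complex_def by blast
        show "2 * i + 1 \<le> card M'" using M'(2) that by simp
      qed (use less.prems(1,2) in auto)
      show "fills i (realization (vertex_link e ?K))" if "i < j" for i
        unfolding vertex_link_matching_complex[OF e(1)]
      proof (rule less.hyps[OF smaller(2)])
        let ?B = "{m \<in> M'. ends m \<inter> ends e \<noteq> {}}"
        have dM: "disjoint_ends ends M'" using M'(1) unfolding matching_complex_def by blast
        show "M' - ?B \<in> matching_complex ends ?L"
          using M'(1) e(2) unfolding matching_complex_def disjoint_ends_def
          by (auto intro: pairwise_subset)
        have "card ?B \<le> 2"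
          using card_matching_meeting_edge(2)[OF dM, of e] less.prems(2)[OF e(1)] by simp
        moreover have "card (M' - ?B) = card M' - card ?B"
          using fM' by (intro card_Diff_subset) auto
        ultimately show "2 * i + 1 \<le> card (M' - ?B)" using M'(2) that by simp
      qed (use less.prems(1,2) in auto)
    qed
  next
    case False
    then have ME: "M = E" using less.prems(3,4) by blast
    then obtain e where e: "e \<in> E" using less.prems(4) by fastforce
    have all: "\<sigma> \<in> ?K" if "\<sigma> \<subseteq> E" for \<sigma>
      using simplicial_complexD(3)[OF K less.prems(3)] that ME by blast
    show ?thesis
      by (rule fills_realization_cone[OF K, of e]) (use e all simplicial_complexD(2)[OF K] in auto)
  qed
qed

section \<open>Fixed points in the unit box\<close>

definition unit_box :: "nat \<Rightarrow> (nat \<Rightarrow> real) set" where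
  "unit_box n = {x. (\<forall>i<n. 0 \<le> x i \<and> x i \<le> 1) \<and> (\<forall>i\<ge>n. x i = 0)}"

lemma compact_unit_box: "compact (unit_box n)"
proof -
  have "compact {x::nat \<Rightarrow> real. \<forall>i. x i \<in> (if i < n then {0..1} else {0})}"
    by (rule compact_product) auto
  moreover have "unit_box n = {x. \<forall>i. x i \<in> (if i < n then {0..1} else {0})}"
  proof (intro set_eqI iffI)
    fix x assume "x \<in> unit_box n"
    then show "x \<in> {x. \<forall>i. x i \<in> (if i < n then {0..1} else {0})}" by (simp add: unit_box_def)
  next
    fix x assume "x \<in> {x. \<forall>i. x i \<in> (if i < n then {0..1::real} else {0})}"
    then have "x i \<in> (if i < n then {0..1} else {0})" for i by blast
    from this show "x \<in> unit_box n"
      unfolding unit_box_def by (smt (verit) atLeastAtMost_iff mem_Collect_eq not_less singletonD)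
  qed
  ultimately show ?thesis by simp
qed

text \<open>Label a point of the grid of mesh \<open>1/p\<close> by the directions in which \<open>f\<close> moves it. By the
combinatorial lemma of Kuhn some small grid cube shows both labels in each direction \<open>i\<close>, that is, it
has a vertex \<open>u i\<close> whose coordinate \<open>i\<close> does not decrease and a vertex \<open>v i\<close> whose coordinate \<open>i\<close> does not
increase.\<close>

lemma almost_fixed_point:
  assumes f: "f ` unit_box n \<subseteq> unit_box n" and p: "0 < (p::nat)"
  obtains z u v where "z \<in> unit_box n"
    "\<And>i. i < n \<Longrightarrow> u i \<in> unit_box n" "\<And>i. i < n \<Longrightarrow> v i \<in> unit_box n"
    "\<And>i. i < n \<Longrightarrow> dist (u i) z \<le> 2 / real p" "\<And>i. i < n \<Longrightarrow> dist (v i) z \<le> 2 / real p"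
    "\<And>i. i < n \<Longrightarrow> u i i \<le> f (u i) i" "\<And>i. i < n \<Longrightarrow> f (v i) i \<le> v i i"
proof -
  define sc where "sc r = (\<lambda>i. if i < n then real (r i) / real p else 0)" for r :: "nat \<Rightarrow> nat"
  define label where "label r i = (if r i = 0 \<or> r i < p \<and> sc r i < f (sc r) i then 0 else 1::nat)" for r i
  have scB: "sc r \<in> unit_box n" if "\<forall>j<n. r j \<le> p" for r
    using that p by (auto simp: sc_def unit_box_def)
  have f01: "0 \<le> f (sc r) i" "f (sc r) i \<le> 1" if "\<forall>j<n. r j \<le> p" "i < n" for r i
  proof -
    have "f (sc r) \<in> unit_box n" using scB[OF that(1)] f by blast
    then show "0 \<le> f (sc r) i" "f (sc r) i \<le> 1" using that(2) by (auto simp: unit_box_def)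
  qed
  have l0: "sc r i \<le> f (sc r) i" if "\<forall>j<n. r j \<le> p" "i < n" "label r i = 0" for r i
    using f01[OF that(1,2)] that(2,3) by (auto simp: label_def sc_def split: if_splits)
  have l1: "f (sc r) i \<le> sc r i" if "\<forall>j<n. r j \<le> p" "i < n" "label r i \<noteq> 0" for r i
  proof (cases "r i < p")
    case True
    then show ?thesis using that(3) by (auto simp: label_def split: if_splits)
  next
    case False
    then have "r i = p" using that(1,2) by (metis antisym_conv not_less)
    then have "sc r i = 1" using that(2) p by (simp add: sc_def)
    then show ?thesis using f01[OF that(1,2)] by simp
  qed
  obtain q where q: "\<forall>i<n. q i < p"
    and rs: "\<forall>i<n. \<exists>r s. (\<forall>j<n. q j \<le> r j \<and> r j \<le> q j + 1) \<and> (\<forall>j<n. q j \<le> s j \<and> s j \<le> q j + 1) \<and>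
        label r i \<noteq> label s i"
    by (rule kuhn_lemma[OF p, of n label]) (use p in \<open>auto simp: label_def\<close>)
  have near: "dist (sc r) (sc q) \<le> 2 / real p" if r: "\<forall>j<n. q j \<le> r j \<and> r j \<le> q j + 1" for r
  proof -
    have "\<bar>sc r j - sc q j\<bar> \<le> 1 / real p" for j
    proof (cases "j < n")
      case True
      then have "\<bar>real (r j) - real (q j)\<bar> \<le> 1" using r by (auto simp: abs_le_iff le_Suc_eq)
      then show ?thesis using True p by (simp add: sc_def field_simps flip: diff_divide_distrib)
    next
      case False
      then show ?thesis by (simp add: sc_def)
    qed
    from dist_fun_le_coordinatewise[of "sc r" "sc q", OF this] show ?thesis by simp
  qed
  have "\<exists>u v. u \<in> unit_box n \<and> v \<in> unit_box n \<and> dist u (sc q) \<le> 2 / real p \<and> dist v (sc q) \<le> 2 / real p \<and>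
      u i \<le> f u i \<and> f v i \<le> v i" if i: "i < n" for i
  proof -
    obtain r s where r: "\<forall>j<n. q j \<le> r j \<and> r j \<le> q j + 1" and s: "\<forall>j<n. q j \<le> s j \<and> s j \<le> q j + 1"
      and rs: "label r i \<noteq> label s i" using rs i by blast
    have rp: "\<forall>j<n. r j \<le> p" "\<forall>j<n. s j \<le> p" using r s q by fastforce+
    consider "label r i = 0" "label s i \<noteq> 0" | "label s i = 0" "label r i \<noteq> 0"
      using rs by (cases "label r i = 0") (auto simp: label_def split: if_splits)
    then show ?thesis
    proof cases
      case 1
      then show ?thesis using scB[OF rp(1)] scB[OF rp(2)] near[OF r] near[OF s] l0[OF rp(1) i] l1[OF rp(2) i]
        by (intro exI[of _ "sc r"] exI[of _ "sc s"]) simp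
    next
      case 2
      then show ?thesis using scB[OF rp(1)] scB[OF rp(2)] near[OF r] near[OF s] l0[OF rp(2) i] l1[OF rp(1) i]
        by (intro exI[of _ "sc s"] exI[of _ "sc r"]) simp
    qed
  qed
  then obtain u v where "\<And>i. i < n \<Longrightarrow> u i \<in> unit_box n \<and> v i \<in> unit_box n \<and> dist (u i) (sc q) \<le> 2 / real p \<and>
      dist (v i) (sc q) \<le> 2 / real p \<and> u i i \<le> f (u i) i \<and> f (v i) i \<le> v i i" by metis
  moreover have "sc q \<in> unit_box n" using q by (intro scB) auto
  ultimately show thesis using that[of "sc q" u v] by blast
qed

text \<open>Brouwer's fixed point theorem in a form where the dimension is a number instead of a type. The
almost fixed points for mesh \<open>1/p\<close> accumulate at a point \<open>l\<close>, at which \<open>f l i - l i\<close> is a limit of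
nonnegative and of nonpositive numbers.\<close>

theorem brouwer_unit_box:
  assumes cf: "continuous_on (unit_box n) f" and f: "f ` unit_box n \<subseteq> unit_box n"
  obtains x where "x \<in> unit_box n" "f x = x"
proof -
  let ?P = "\<lambda>k z u v. z \<in> unit_box n \<and> (\<forall>i<n. u i \<in> unit_box n \<and> v i \<in> unit_box n \<and>
    dist (u i) z \<le> 2 / real (Suc k) \<and> dist (v i) z \<le> 2 / real (Suc k) \<and> u i i \<le> f (u i) i \<and> f (v i) i \<le> v i i)"
  have "\<forall>k. \<exists>z u v. ?P k z u v"
  proof
    fix k show "\<exists>z u v. ?P k z u v"
      by (rule almost_fixed_point[OF f zero_less_Suc[of k]]) blast
  qed
  then have "\<exists>z u v. \<forall>k. ?P k (z k) (u k) (v k)" by (simp only: choice_iff)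
  then obtain z u v where P: "\<And>k. ?P k (z k) (u k) (v k)" by blast
  have "seq_compact (unit_box n)" using compact_unit_box by (simp add: compact_eq_seq_compact_metric)
  moreover have "\<forall>k. z k \<in> unit_box n" using P by blast
  ultimately obtain l r where l: "l \<in> unit_box n" and r: "strict_mono r" and zl: "(z \<circ> r) \<longlonglongrightarrow> l"
    unfolding seq_compact_def by blast
  have small: "(\<lambda>k. 2 / real (Suc (r k))) \<longlonglongrightarrow> 0"
    using LIMSEQ_subseq_LIMSEQ[OF lim_const_over_n[THEN LIMSEQ_Suc, of 2] r] by (simp add: comp_def)
  have lim: "(\<lambda>k. w (r k)) \<longlonglongrightarrow> l" if w: "\<And>k. dist (w k) (z k) \<le> 2 / real (Suc k)" for w
  proof -
    have "(\<lambda>k. dist ((z \<circ> r) k) l) \<longlonglongrightarrow> 0" by (rule iffD1[OF tendsto_dist_iff zl])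
    then have "(\<lambda>k. 2 / real (Suc (r k)) + dist ((z \<circ> r) k) l) \<longlonglongrightarrow> 0 + 0"
      by (intro tendsto_add small)
    then have s0: "(\<lambda>k. 2 / real (Suc (r k)) + dist ((z \<circ> r) k) l) \<longlonglongrightarrow> 0" by simp
    have "(\<lambda>k. dist (w (r k)) l) \<longlonglongrightarrow> 0"
    proof (rule tendsto_sandwich[OF _ _ tendsto_const s0])
      show "\<forall>\<^sub>F k in sequentially. dist (w (r k)) l \<le> 2 / real (Suc (r k)) + dist ((z \<circ> r) k) l"
        using w by (intro always_eventually allI) (metis add_right_mono comp_apply dist_triangle order_trans)
    qed auto
    then show ?thesis by (rule iffD2[OF tendsto_dist_iff])
  qed
  have "f l i = l i" for i
  proof (cases "i < n")
    case False
    moreover have "f l \<in> unit_box n" using l f by blast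
    ultimately show ?thesis using l by (simp add: unit_box_def)
  next
    case True
    have cg: "continuous_on (unit_box n) (\<lambda>x. f x i - x i)"
      by (intro continuous_intros continuous_on_product_then_coordinatewise[OF cf] continuous_on_coord)
    have seq: "(\<lambda>k. f (w k) i - w k i) \<longlonglongrightarrow> f l i - l i" if "\<And>k. w k \<in> unit_box n" "w \<longlonglongrightarrow> l" for w
      using cg that l unfolding continuous_on_sequentially comp_def by blast
    have "(\<lambda>k. f (u (r k) i) i - u (r k) i i) \<longlonglongrightarrow> f l i - l i"
      by (rule seq, use P True in blast, rule lim[of "\<lambda>k. u k i"]) (use P True in blast)
    then have "0 \<le> f l i - l i" by (rule LIMSEQ_le_const) (use P True in force)
    moreover have "(\<lambda>k. f (v (r k) i) i - v (r k) i i) \<longlonglongrightarrow> f l i - l i"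
      by (rule seq, use P True in blast, rule lim[of "\<lambda>k. v k i"]) (use P True in blast)
    then have "f l i - l i \<le> 0" by (rule LIMSEQ_le_const2) (use P True in force)
    ultimately show ?thesis by simp
  qed
  then have "f l = l" by (rule ext)
  then show thesis using that l by blast
qed

section \<open>Colourful simplices\<close>

text \<open>A topological Hall theorem with deficiency. Suppose that for every set \<open>T\<close> of fewer than \<open>m\<close>
colours the subcomplex avoiding \<open>T\<close> is \<open>(m - 2 - card T)\<close>-connected. Then some simplex shows at
least \<open>m\<close> colours.

Let \<open>Q\<close> be the set of points of the unit box with fewer than \<open>m\<close> nonzero coordinates. It is a union of
faces of the box, and the face of all points that are \<open>1\<close> on \<open>T\<close> and \<open>0\<close> off \<open>T'\<close> has dimension
\<open>card T' - card T < m - card T\<close>. By the carrier lemma there is a map \<open>F\<close> from \<open>Q\<close> into the complex such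
that \<open>F y\<close> avoids every colour \<open>i\<close> with \<open>y i = 1\<close>. Let \<open>h\<close> be a map of the whole box into \<open>Q\<close>, and
let \<open>G y\<close> record the total weight that \<open>F (h y)\<close> gives to each colour. If no simplex shows \<open>m\<close> colours,
then a fixed point \<open>y\<close> of \<open>G\<close> has fewer than \<open>m\<close> nonzero coordinates. On such points, if their sum
is \<open>1\<close>, the map \<open>h\<close> is made to raise a largest coordinate to \<open>1\<close>; so \<open>F (h y)\<close> avoids that colour,
but by \<open>G y = y\<close> it gives that colour positive weight.\<close>

theorem rainbow_simplex:
  fixes col :: "'e \<Rightarrow> nat"
  assumes K: "simplicial_complex E K" and col: "\<And>e. e \<in> E \<Longrightarrow> col e < n" and m: "0 < m"
    and fl: "\<And>T j. T \<subseteq> {..<n} \<Longrightarrow> card T + j < m \<Longrightarrow>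
        fills j (realization {\<sigma> \<in> K. \<forall>e\<in>\<sigma>. col e \<notin> T})"
  obtains \<sigma> where "\<sigma> \<in> K" "m \<le> card (col ` \<sigma>)"
proof (rule ccontr)
  assume "\<not> thesis"
  with that have small: "card (col ` \<sigma>) < m" if "\<sigma> \<in> K" for \<sigma>
    using \<open>\<sigma> \<in> K\<close> not_le by blast
  \<comment> \<open>The face of the points that are 1 on T and 0 outside T', encoded by its lowest
    corner and its free directions. Its region consists of the points of the complex that avoid the
    colours at which the corner is 1, that is, the colours in T.\<close>
  define \<C> where "\<C> = (\<lambda>(T, T'). ((\<lambda>i. if i \<in> T then 1 else 0 :: int), T' - T)) `
    {(T, T'). T \<subseteq> T' \<and> T' \<subseteq> {..<n} \<and> card T' < m}"
  define X where "X a J = realization {\<sigma> \<in> K. \<forall>e\<in>\<sigma>. a (col e) \<noteq> (1::int)}" for a and J :: "nat set"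
  have "\<exists>g. continuous_on ({} \<union> (\<Union>(a, J)\<in>\<C>. cell a J)) g \<and> (\<forall>x\<in>{}. g x = undefined x) \<and>
             (\<forall>(a, J)\<in>\<C>. g ` cell a J \<subseteq> X a J)"
  proof (rule carrier_extension)
    have "{(T, T'). T \<subseteq> T' \<and> T' \<subseteq> {..<n} \<and> card T' < m} \<subseteq> Pow {..<n} \<times> Pow {..<n}" by auto
    then show "finite \<C>" unfolding \<C>_def by (intro finite_imageI) (rule finite_subset, auto)
    fix a J assume "(a, J) \<in> \<C>"
    then obtain T T' where T: "T \<subseteq> T'" "T' \<subseteq> {..<n}" "card T' < m"
      and a: "a = (\<lambda>i. if i \<in> T then 1 else 0)" and J: "J = T' - T" unfolding \<C>_def by auto
    have fT': "finite T'" using T(2) finite_subset by blast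
    then show "finite J" unfolding J by simp
    have "card T + card J < m"
      using T fT' unfolding J by (simp add: card_Diff_subset finite_subset card_mono)
    then show "fills (card J) (X a J)"
      using fl[of T "card J"] T unfolding X_def a by auto
    fix i b assume i: "i \<in> J" and b: "b \<in> {a, a(i := a i + 1)}"
    show "cell b (J - {i}) \<subseteq> {} \<or> (b, J - {i}) \<in> \<C> \<and> X b (J - {i}) \<subseteq> X a J"
    proof (cases "b = a")
      case True
      have "(T, T' - {i}) \<in> {(T, T'). T \<subseteq> T' \<and> T' \<subseteq> {..<n} \<and> card T' < m}"
        using T i fT' unfolding J by (auto intro: le_less_trans[OF card_Diff1_le])
      moreover have "(b, J - {i}) = (\<lambda>(T, T'). ((\<lambda>i. if i \<in> T then 1 else 0 :: int), T' - T)) (T, T' - {i})"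
        using True a J by auto
      ultimately have "(b, J - {i}) \<in> \<C>" unfolding \<C>_def by (metis (no_types, lifting) image_eqI)
      then show ?thesis using True unfolding X_def by simp
    next
      case False
      then have b: "b = a(i := 1)" using b i unfolding a J by auto
      have "(insert i T, T') \<in> {(T, T'). T \<subseteq> T' \<and> T' \<subseteq> {..<n} \<and> card T' < m}"
        using T i unfolding J by auto
      moreover have "(b, J - {i}) = (\<lambda>(T, T'). ((\<lambda>i. if i \<in> T then 1 else 0 :: int), T' - T)) (insert i T, T')"
        using b a J by (auto simp: fun_eq_iff)
      ultimately have "(b, J - {i}) \<in> \<C>" unfolding \<C>_def by (metis (no_types, lifting) image_eqI)
      moreover have "X b (J - {i}) \<subseteq> X a J"
        unfolding X_def b realization_def by (auto split: if_splits)
      ultimately show ?thesis by simp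
    qed
  qed auto
  then obtain F where F: "continuous_on (\<Union>(a, J)\<in>\<C>. cell a J) F"
    and FX: "\<forall>(a, J)\<in>\<C>. F ` cell a J \<subseteq> X a J" by auto
  define Q where "Q = {y \<in> unit_box n. card {i. y i \<noteq> 0} < m}"
  have Qcell: "\<exists>a J. (a, J) \<in> \<C> \<and> y \<in> cell a J \<and> (\<forall>i. a i = 1 \<longleftrightarrow> y i = 1)" if y: "y \<in> Q" for y
  proof -
    let ?T = "{i. y i = 1}" and ?T' = "{i. y i \<noteq> 0}"
    have y0: "\<And>i. n \<le> i \<Longrightarrow> y i = 0" and y01: "\<And>i. 0 \<le> y i \<and> y i \<le> 1"
      using y by (auto simp: Q_def unit_box_def) (metis not_le order_refl zero_le_one)+
    have "?T' \<subseteq> {..<n}" using y0 by (auto simp: not_less[symmetric])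
    then have "(?T, ?T') \<in> {(T, T'). T \<subseteq> T' \<and> T' \<subseteq> {..<n} \<and> card T' < m}" using y by (auto simp: Q_def)
    then have "((\<lambda>i. if i \<in> ?T then 1 else 0), ?T' - ?T) \<in> \<C>" unfolding \<C>_def by (rule rev_image_eqI) simp
    moreover have "y \<in> cell (\<lambda>i. if i \<in> ?T then 1 else 0) (?T' - ?T)"
      using y01 by (auto simp: cell_def)
    ultimately show ?thesis by (intro exI conjI) (auto split: if_splits)
  qed
  have FQ: "F y \<in> realization {\<sigma> \<in> K. \<forall>e\<in>\<sigma>. y (col e) \<noteq> 1}" if yQ: "y \<in> Q" for y
  proof -
    obtain a J where aJ: "(a, J) \<in> \<C>" "y \<in> cell a J" "\<forall>i. a i = 1 \<longleftrightarrow> y i = 1" using Qcell[OF yQ] by blast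
    then have "F y \<in> X a J" using bspec[OF FX aJ(1)] by auto
    then show ?thesis using aJ(3) unfolding X_def by simp
  qed
  have cF: "continuous_on Q F"
    by (rule continuous_on_subset[OF F]) (use Qcell in fast)
  \<comment> \<open>A continuous threshold that fewer than m coordinates can exceed: if all
    coordinates in an m-set T exceeded t y, their product would be greater than (t y)^m, which is a
    sum containing that product. It vanishes if fewer than m coordinates are nonzero.\<close>
  define t where "t y = root m (\<Sum>T | T \<subseteq> {..<n} \<and> card T = m. \<Prod>i\<in>T. y i)" for y :: "nat \<Rightarrow> real"
  \<comment> \<open>The factor n raises to 1 every coordinate that is at least 1/n; if the threshold
    is 0 and the coordinates sum to 1, there is such a coordinate.\<close>
  define h where "h y = (\<lambda>i. if i < n then min 1 (real n * max 0 (y i - t y)) else 0)" for y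
  have finT: "finite {T. T \<subseteq> {..<n} \<and> card T = m}"
    by (rule finite_subset[of _ "Pow {..<n}"]) auto
  have ct: "continuous_on (unit_box n) t"
    unfolding t_def by (intro continuous_intros continuous_on_coord)
  have ch: "continuous_on (unit_box n) h" unfolding h_def
  proof (rule continuous_on_coordinatewise_then_product)
    fix i
    show "continuous_on (unit_box n) (\<lambda>y. if i < n then min 1 (real n * max 0 (y i - t y)) else 0)"
      by (cases "i < n") (auto intro!: continuous_intros continuous_on_coord ct)
  qed
  have hQ: "h y \<in> Q" if y: "y \<in> unit_box n" for y
  proof -
    have pos: "0 \<le> (\<Prod>i\<in>T. y i)" if "T \<subseteq> {..<n}" for T
      using that y by (intro prod_nonneg) (auto simp: unit_box_def)
    then have sum0: "0 \<le> (\<Sum>T | T \<subseteq> {..<n} \<and> card T = m. \<Prod>i\<in>T. y i)" by (intro sum_nonneg) auto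
    then have t0: "0 \<le> t y" unfolding t_def by (rule real_root_ge_zero)
    have tm: "t y ^ m = (\<Sum>T | T \<subseteq> {..<n} \<and> card T = m. \<Prod>i\<in>T. y i)"
      unfolding t_def using sum0 m by simp
    have "card {i. h y i \<noteq> 0} < m"
    proof (rule ccontr)
      assume "\<not> card {i. h y i \<noteq> 0} < m"
      then obtain T where T: "T \<subseteq> {i. h y i \<noteq> 0}" "card T = m"
        by (meson not_less obtain_subset_with_card_n)
      have Tn: "T \<subseteq> {..<n}" using T(1) by (auto simp: h_def split: if_splits)
      have gt: "t y < y i" if "i \<in> T" for i
      proof (rule ccontr)
        assume "\<not> t y < y i"
        then have "h y i = 0" by (simp add: h_def max_def)
        then show False using that T(1) by blast
      qed
      have "finite T" "T \<noteq> {}" using Tn T(2) m finite_subset by auto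
      then obtain i where "i \<in> T" by blast
      then have "(\<Prod>i\<in>T. t y) < (\<Prod>i\<in>T. y i)"
        using gt t0 \<open>finite T\<close> by (intro prod_mono_strict[of i]) (auto intro: order.strict_trans1 less_imp_le)
      also have "(\<Prod>i\<in>T. y i) \<le> t y ^ m"
        unfolding tm using pos finT T(2) Tn by (intro member_le_sum) auto
      finally show False using T(2) by simp
    qed
    moreover have "h y \<in> unit_box n" by (auto simp: h_def unit_box_def)
    ultimately show ?thesis unfolding Q_def by simp
  qed
  define G where "G y = (\<lambda>i. \<Sum>e | e \<in> E \<and> col e = i. F (h y) e)" for y
  have FR: "F (h y) \<in> realization K" if "y \<in> unit_box n" for y
    using FQ[OF hQ[OF that]] by (auto simp: realization_def)
  have Fpos: "0 \<le> F (h y) e" if "y \<in> unit_box n" for y e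
    using FR[OF that] by (simp add: realization_def)
  have Fsum: "(\<Sum>e\<in>E. F (h y) e) = 1" if "y \<in> unit_box n" for y
    using FR[OF that] unfolding realization_iff[OF K] by blast
  have finE: "finite E" by (rule simplicial_complexD(1)[OF K])
  obtain y where y: "y \<in> unit_box n" and fix_y: "G y = y"
  proof (rule brouwer_unit_box)
    show "continuous_on (unit_box n) G" unfolding G_def
    proof (rule continuous_on_coordinatewise_then_product)
      fix i
      have "continuous_on (unit_box n) (\<lambda>y. F (h y))"
        by (rule continuous_on_compose2[OF cF ch image_subsetI[OF hQ]])
      then have "continuous_on (unit_box n) (\<lambda>y. F (h y) e)" for e
        by (rule continuous_on_product_then_coordinatewise)
      then show "continuous_on (unit_box n) (\<lambda>y. \<Sum>e | e \<in> E \<and> col e = i. F (h y) e)"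
        by (rule continuous_on_sum)
    qed
    show "G ` unit_box n \<subseteq> unit_box n"
    proof
      fix x assume "x \<in> G ` unit_box n"
      then obtain y where y: "y \<in> unit_box n" "x = G y" by blast
      have "0 \<le> G y i" for i unfolding G_def using Fpos[OF y(1)] by (intro sum_nonneg) auto
      moreover have "G y i \<le> 1" for i
        unfolding G_def Fsum[OF y(1), symmetric] using Fpos[OF y(1)] finE by (intro sum_mono2) auto
      moreover have "G y i = 0" if "n \<le> i" for i
      proof -
        have "{e. e \<in> E \<and> col e = i} = {}" using col that by force
        then show ?thesis unfolding G_def by (metis sum.empty)
      qed
      ultimately show "x \<in> unit_box n" using y(2) by (simp add: unit_box_def)
    qed
  qed
  let ?x = "F (h y)"
  have supp: "y i \<noteq> 0 \<longleftrightarrow> i \<in> col ` {e. ?x e \<noteq> 0}" for i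
  proof -
    have "{e. ?x e \<noteq> 0} \<subseteq> E" using FR[OF y] simplicial_complexD(2)[OF K] by (simp add: realization_def)
    moreover have "y i = (\<Sum>e | e \<in> E \<and> col e = i. ?x e)" using fix_y unfolding G_def by metis
    moreover have "(\<Sum>e | e \<in> E \<and> col e = i. ?x e) = 0 \<longleftrightarrow> (\<forall>e\<in>{e. e \<in> E \<and> col e = i}. ?x e = 0)"
      using finE Fpos[OF y] by (intro sum_nonneg_eq_0_iff) auto
    ultimately show ?thesis by auto
  qed
  have "(\<Sum>i<n. y i) = (\<Sum>i<n. \<Sum>e | e \<in> E \<and> col e = i. ?x e)" using fix_y unfolding G_def by metis
  also have "\<dots> = (\<Sum>e\<in>E. ?x e)" by (rule sum.group[OF finE]) (use col in auto)
  finally have sum1: "(\<Sum>i<n. y i) = 1" using Fsum[OF y] by simp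
  have "\<exists>i<n. 1 \<le> real n * y i"
  proof (rule ccontr)
    assume "\<not> (\<exists>i<n. 1 \<le> real n * y i)"
    then have lt: "real n * y i < 1" if "i < n" for i using that by force
    have "0 < n" using sum1 by (cases n) auto
    then have "(\<Sum>i<n. real n * y i) < (\<Sum>i<n. 1)" using lt by (intro sum_strict_mono) auto
    then show False using sum1 by (simp flip: sum_distrib_left)
  qed
  then obtain i where i: "i < n" "1 \<le> real n * y i" by blast
  have "{i. y i \<noteq> 0} = col ` {e. ?x e \<noteq> 0}" using supp by blast
  moreover have "{e. ?x e \<noteq> 0} \<in> K" using FR[OF y] by (simp add: realization_def)
  ultimately have suppm: "card {i. y i \<noteq> 0} < m" using small by simp
  have "(\<Prod>i\<in>T. y i) = 0" if T: "T \<subseteq> {..<n}" "card T = m" for T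
  proof (rule ccontr)
    assume nz: "(\<Prod>i\<in>T. y i) \<noteq> 0"
    have finT: "finite T" using T(1) finite_subset by blast
    then have "T \<subseteq> {i. y i \<noteq> 0}" using nz by auto
    moreover have "finite {i. y i \<noteq> 0}"
      by (rule finite_subset[of _ "{..<n}"]) (use y in \<open>auto simp: unit_box_def not_less[symmetric]\<close>)
    ultimately have "card T \<le> card {i. y i \<noteq> 0}" by (intro card_mono)
    then show False using T(2) suppm by simp
  qed
  then have "t y = 0" unfolding t_def by (simp add: m)
  moreover have "0 \<le> y i" using y i(1) by (simp add: unit_box_def)
  ultimately have "h y i = 1" using i by (simp add: h_def)
  moreover have "y i \<noteq> 0" using i by auto
  then obtain e where "?x e \<noteq> 0" "col e = i" using supp[of i] by auto
  moreover have "{e. ?x e \<noteq> 0} \<in> {\<sigma> \<in> K. \<forall>e\<in>\<sigma>. h y (col e) \<noteq> 1}"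
    using FQ[OF hQ[OF y]] by (simp add: realization_def)
  ultimately show False by auto
qed

section \<open>Matchings and covers in bipartite graphs\<close>

text \<open>Koenig's theorem, by the argument of Lovasz. Let \<open>C\<close> be a minimum cover. If some edge can be deleted
without lowering the covering number, induction applies. Otherwise the edges are disjoint, so that
\<open>E\<close> itself is the matching. For suppose that edges \<open>e\<close> and \<open>f\<close> share a vertex \<open>x\<close>, and let \<open>D\<close> and \<open>F\<close> be
smaller covers of \<open>E - {e}\<close> and \<open>E - {f}\<close>. Every edge that misses \<open>D \<inter> F\<close> has both ends in the set \<open>S\<close>
consisting of \<open>x\<close> and the symmetric difference of \<open>D\<close> and \<open>F\<close>. Hence such edges are covered by
\<open>S \<inter> L\<close> as well as by \<open>S \<inter> R\<close>, and the smaller of these together with \<open>D \<inter> F\<close> is a cover of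
\<open>E\<close> that is smaller than \<open>C\<close>.\<close>

lemma konig:
  assumes "finite E" and ends: "\<And>e. e \<in> E \<Longrightarrow> \<exists>l\<in>L. \<exists>r\<in>R. ends e = {l, r}" and LR: "L \<inter> R = {}"
  shows "\<exists>M C. M \<subseteq> E \<and> disjoint_ends ends M \<and> finite C \<and> (\<forall>e\<in>E. ends e \<inter> C \<noteq> {}) \<and> card C \<le> card M"
  using assms(1,2)
proof (induction "card E" arbitrary: E rule: less_induct)
  case less
  define cov where "cov E C \<longleftrightarrow> finite C \<and> (\<forall>e\<in>E. ends e \<inter> C \<noteq> {})" for E C
  have "cov E (\<Union>(ends ` E))" unfolding cov_def using less.prems by fastforce
  then obtain C where C: "cov E C" and Cmin: "\<And>C'. cov E C' \<Longrightarrow> card C \<le> card C'"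
    using ex_has_least_nat[of "cov E" _ card] by blast
  show ?case
  proof (cases "\<exists>e\<in>E. \<forall>C'. cov (E - {e}) C' \<longrightarrow> card C \<le> card C'")
    case True
    then obtain e where e: "e \<in> E" "\<And>C'. cov (E - {e}) C' \<Longrightarrow> card C \<le> card C'" by blast
    have "card (E - {e}) < card E" using e(1) less.prems(1) by (rule card_Diff1_less[rotated])
    then have "\<exists>M C. M \<subseteq> E - {e} \<and> disjoint_ends ends M \<and> finite C \<and> (\<forall>e\<in>E - {e}. ends e \<inter> C \<noteq> {}) \<and>
        card C \<le> card M"
      by (rule less.hyps) (use less.prems in auto)
    then obtain M C' where M: "M \<subseteq> E - {e}" "disjoint_ends ends M" "cov (E - {e}) C'" "card C' \<le> card M"
      unfolding cov_def by blast
    then have "card C \<le> card M" using e(2) order_trans by blast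
    then show ?thesis using M C unfolding cov_def by blast
  next
    case False
    then have crit: "\<exists>C'. cov (E - {e}) C' \<and> card C' < card C" if "e \<in> E" for e
      using that not_le by blast
    have "disjoint_ends ends E" unfolding disjoint_ends_def
    proof (rule pairwiseI, rule ccontr)
      fix e f assume ef: "e \<in> E" "f \<in> E" "e \<noteq> f" and "ends e \<inter> ends f \<noteq> {}"
      then obtain x where x: "x \<in> ends e" "x \<in> ends f" by blast
      obtain D where D: "cov (E - {e}) D" "card D < card C" using crit[OF ef(1)] by blast
      obtain F where F: "cov (E - {f}) F" "card F < card C" using crit[OF ef(2)] by blast
      have De: "ends e \<inter> D = {}"
      proof (rule ccontr)
        assume "ends e \<inter> D \<noteq> {}"
        then have "cov E D" using D(1) unfolding cov_def by blast
        then show False using Cmin D(2) not_le by blast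
      qed
      have Ff: "ends f \<inter> F = {}"
      proof (rule ccontr)
        assume "ends f \<inter> F \<noteq> {}"
        then have "cov E F" using F(1) unfolding cov_def by blast
        then show False using Cmin F(2) not_le by blast
      qed
      have fD: "finite D" and fF: "finite F" using D F unfolding cov_def by auto
      define S where "S = insert x ((D - F) \<union> (F - D))"
      have two: "ends g \<subseteq> {u, w}" if "g \<in> E" "u \<in> ends g" "w \<in> ends g" "u \<noteq> w" for g u w
        using less.prems(2)[OF that(1)] that by auto
      have gS: "ends g \<subseteq> S" if g: "g \<in> E" "ends g \<inter> (D \<inter> F) = {}" for g
      proof -
        consider "g = e" | "g = f" | "g \<noteq> e" "g \<noteq> f" by blast
        then show ?thesis
        proof cases
          case 1
          then obtain w where "w \<in> ends e" "w \<in> F" using F(1) ef unfolding cov_def by blast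
          then show ?thesis using two[of e x w] 1 De Ff x ef unfolding S_def by blast
        next
          case 2
          then obtain w where "w \<in> ends f" "w \<in> D" using D(1) ef unfolding cov_def by blast
          then show ?thesis using two[of f x w] 2 De Ff x ef unfolding S_def by blast
        next
          case 3
          then obtain u w where "u \<in> ends g" "u \<in> D" "w \<in> ends g" "w \<in> F"
            using D(1) F(1) g(1) unfolding cov_def by blast
          then show ?thesis using two[of g u w] g unfolding S_def by blast
        qed
      qed
      have fS: "finite S" using fD fF unfolding S_def by simp
      have "card S \<le> Suc (card (D - F) + card (F - D))"
        unfolding S_def using card_Un_le[of "D - F" "F - D"]
        by (simp add: card_insert_if fD fF)
      moreover have "card D = card (D - F) + card (D \<inter> F)"
        using fD by (metis Diff_disjoint Int_Diff_disjoint Int_Diff_Un card_Un_disjoint finite_Diff finite_Int add.commute)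
      moreover have "card F = card (F - D) + card (D \<inter> F)"
        using fF by (metis Int_Diff_disjoint Int_Diff_Un card_Un_disjoint finite_Diff finite_Int add.commute Int_commute)
      ultimately have S: "card S + 2 * card (D \<inter> F) + 1 \<le> 2 * card C" using D(2) F(2) by simp
      have "card (S \<inter> L) + card (S \<inter> R) = card ((S \<inter> L) \<union> (S \<inter> R))"
        using fS LR by (intro card_Un_disjoint[symmetric]) auto
      also have "\<dots> \<le> card S" using fS by (intro card_mono) auto
      finally have "\<exists>T. (T = S \<inter> L \<or> T = S \<inter> R) \<and> 2 * card T \<le> card S"
        by (cases "card (S \<inter> L) \<le> card (S \<inter> R)") (force intro: exI[of _ "S \<inter> L"], force intro: exI[of _ "S \<inter> R"])
      then obtain T where T: "T = S \<inter> L \<or> T = S \<inter> R" "2 * card T \<le> card S" by blast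
      have "cov E (T \<union> (D \<inter> F))" unfolding cov_def
      proof (intro conjI ballI)
        show "finite (T \<union> (D \<inter> F))" using T(1) fS fD by auto
        fix g assume g: "g \<in> E"
        show "ends g \<inter> (T \<union> D \<inter> F) \<noteq> {}"
        proof (cases "ends g \<inter> (D \<inter> F) = {}")
          case True
          then have "ends g \<subseteq> S" using gS g by blast
          then show ?thesis using less.prems(2)[OF g] T(1) by blast
        qed blast
      qed
      then have "card C \<le> card (T \<union> (D \<inter> F))" by (rule Cmin)
      also have "\<dots> \<le> card T + card (D \<inter> F)" by (rule card_Un_le)
      finally show False using S T(2) by linarith
    qed
    moreover have "card C \<le> card E"
    proof -
      have "\<forall>e\<in>E. \<exists>x. x \<in> ends e" using less.prems(2) by fastforce
      then have "\<exists>p. \<forall>e\<in>E. p e \<in> ends e" by (rule bchoice)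
      then obtain p where p: "\<forall>e\<in>E. p e \<in> ends e" by blast
      then have "cov E (p ` E)" using less.prems(1) unfolding cov_def by blast
      then show ?thesis using Cmin card_image_le[OF less.prems(1)] order_trans by blast
    qed
    ultimately show ?thesis using C unfolding cov_def by blast
  qed
qed

section \<open>Line graphs, links and covers\<close>

lemma conn_eq_fills:
  assumes "\<And>j. j < N \<Longrightarrow> fills j X" and nf: "\<not> fills N X"
  shows "conn (top_of_set X) = ereal (real N - 2)"
proof (cases "N = 0")
  case True
  then have "X = {}" using nf by (simp add: fills_0_iff)
  then show ?thesis using True by (simp add: conn_def)
next
  case False
  then have "X \<noteq> {}" using assms(1)[of 0] by (simp add: fills_0_iff)
  have kc: "k_connected k (top_of_set X) \<longleftrightarrow> k \<le> int N - 2" for k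
  proof
    assume "k_connected k (top_of_set X)"
    then show "k \<le> int N - 2" using nf unfolding k_connected_iff_fills by force
  next
    assume "k \<le> int N - 2"
    then show "k_connected k (top_of_set X)" using assms(1) unfolding k_connected_iff_fills by simp
  qed
  have "(GREATEST k. - 1 \<le> k \<and> k_connected k (top_of_set X)) = int N - 2"
    unfolding kc using False by (intro Greatest_equality) auto
  moreover have "\<not> (\<forall>k\<ge>-1. k_connected k (top_of_set X))"
    unfolding kc using False by (auto intro!: exI[of _ "int N"])
  ultimately show ?thesis using \<open>X \<noteq> {}\<close> by (simp add: conn_def)
qed

lemma finite_edge_copies: "finite (edge_copies G)"
proof (rule finite_subset)
  show "edge_copies G \<subseteq> set_mset (edges G) \<times> {..<size (edges G)}"
  proof (rule subrelI)
    fix e k assume "(e, k) \<in> edge_copies G"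
    then have k: "k < count (edges G) e" by (simp add: edge_copies_def)
    then have "e \<in># edges G" by (simp flip: count_greater_zero_iff)
    then show "(e, k) \<in> set_mset (edges G) \<times> {..<size (edges G)}"
      using k count_le_size[of "edges G" e] by simp
  qed
qed simp

lemma edge_copiesD: "x \<in> edge_copies G \<Longrightarrow> fst x \<in># edges G"
  unfolding edge_copies_def by (auto simp flip: count_greater_zero_iff)

lemma matching_iff: "matching G M \<longleftrightarrow> M \<in> matching_complex fst (edge_copies G)"
  unfolding matching_def matching_complex_def disjoint_ends_def by simp

lemma independence_complex_line_graph:
  "independence_complex (line_graph G) = matching_complex fst (edge_copies G)"
proof -
  let ?S = "{{x, y} | x y. x \<in> edge_copies G \<and> y \<in> edge_copies G \<and> x \<noteq> y \<and> fst x \<inter> fst y \<noteq> {}}"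
  have "?S \<subseteq> Pow (edge_copies G)" by blast
  then have "finite ?S" by (rule finite_subset) (simp add: finite_edge_copies)
  then have es: "set_mset (edges (line_graph G)) = ?S" by (simp add: line_graph_def)
  have vs: "vertices (line_graph G) = edge_copies G" by (simp add: line_graph_def)
  have "(\<forall>e\<in>?S. \<not> e \<subseteq> I) \<longleftrightarrow> disjoint_ends fst I" if I: "I \<subseteq> edge_copies G" for I
  proof
    assume L: "\<forall>e\<in>?S. \<not> e \<subseteq> I"
    show "disjoint_ends fst I" unfolding disjoint_ends_def
    proof (rule pairwiseI, rule ccontr)
      fix x y assume xy: "x \<in> I" "y \<in> I" "x \<noteq> y" "fst x \<inter> fst y \<noteq> {}"
      then have "x \<in> edge_copies G" "y \<in> edge_copies G" using I by auto
      then have "{x, y} \<in> ?S" using xy(3,4) by blast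
      then show False using bspec[OF L, of "{x, y}"] xy(1,2) by simp
    qed
  next
    assume R: "disjoint_ends fst I"
    show "\<forall>e\<in>?S. \<not> e \<subseteq> I"
    proof (intro ballI notI)
      fix e assume "e \<in> ?S" "e \<subseteq> I"
      then obtain x y where "x \<noteq> y" "fst x \<inter> fst y \<noteq> {}" "x \<in> I" "y \<in> I" by blast
      then show False using R unfolding disjoint_ends_def pairwise_def by blast
    qed
  qed
  then show ?thesis unfolding independence_complex_def matching_complex_def es vs by (simp cong: conj_cong)
qed

lemma graph_conn_line_graph:
  "graph_conn (line_graph G) = conn (top_of_set (realization (matching_complex fst (edge_copies G))))"
  unfolding graph_conn_def independence_complex_line_graph geometric_realization_eq ..

lemma finite_matchings: "finite {M. matching G M}"
  by (rule finite_subset[of _ "Pow (edge_copies G)"]) (auto simp: matching_def finite_edge_copies)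

lemma card_le_matching_number: "matching G M \<Longrightarrow> card M \<le> matching_number G"
  unfolding matching_number_def by (rule Max_ge) (use finite_matchings in auto)

lemma matching_number_attained: "\<exists>M. matching G M \<and> card M = matching_number G"
proof -
  have "matching G {}" by (simp add: matching_def)
  then have "matching_number G \<in> card ` {M. matching G M}"
    unfolding matching_number_def using finite_matchings by (intro Max_in) auto
  then show ?thesis by auto
qed

lemma cover_number_le:
  assumes "finite (vertices H)" "vertex_cover H C" shows "cover_number H \<le> card C"
proof -
  have "finite {C. vertex_cover H C}"
    by (rule finite_subset[of _ "Pow (vertices H)"]) (auto simp: vertex_cover_def assms(1))
  then show ?thesis unfolding cover_number_def using assms(2) by (intro Min_le) auto
qed

lemma edges_link: "edges (link H A A) = image_mset (\<lambda>e. e - A) (edges H)"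
proof -
  have "{#e \<in># edges H. e \<inter> A \<subseteq> A#} = edges H" by (induction "edges H") auto
  then show ?thesis by (simp add: link_def)
qed

text \<open>An edge of the link forgets the vertex of \<open>A\<close> it came from, but each pair occurs at least as
often as there are vertices of \<open>A\<close> that complete it. So the parallel copies can be labelled by
such vertices in a way that every edge of \<open>H\<close> is recovered from some copy.\<close>

lemma link_apex:
  assumes A: "\<And>e. e \<in># edges H \<Longrightarrow> card (e \<inter> A) = 1"
  obtains apex where
    "\<And>x. x \<in> edge_copies (link H A A) \<Longrightarrow> apex x \<in> A \<and> insert (apex x) (fst x) \<in># edges H"
    "\<And>e. e \<in># edges H \<Longrightarrow> \<exists>x \<in> edge_copies (link H A A). fst x = e - A \<and> e = insert (apex x) (fst x)"
proof -
  let ?M = "edges (link H A A)"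
  define W where "W g = {v \<in> A. insert v g \<in># edges H}" for g
  have dec: "\<exists>v. v \<in> W (e - A) \<and> e = insert v (e - A)" if e: "e \<in># edges H" for e
  proof -
    obtain v where v: "e \<inter> A = {v}" using A[OF e] card_1_singletonE by blast
    then have "e = insert v (e - A)" by blast
    then show ?thesis using v e unfolding W_def by (metis (mono_tags, lifting) Int_iff insertI1 mem_Collect_eq)
  qed
  have W: "finite (W g) \<and> card (W g) \<le> count ?M g" if g: "g \<in># ?M" for g
  proof -
    let ?P = "(\<lambda>e. e - A) -` {g} \<inter> set_mset (edges H)"
    have gA: "g \<inter> A = {}" using g unfolding edges_link by auto
    have inj: "inj_on (\<lambda>v. insert v g) (W g)" using gA unfolding W_def inj_on_def by blast
    have sub: "(\<lambda>v. insert v g) ` W g \<subseteq> ?P" using gA unfolding W_def by auto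
    have "card (W g) \<le> card ?P" using card_inj_on_le[OF inj sub] by simp
    also have "\<dots> = (\<Sum>e\<in>?P. 1)" by simp
    also have "\<dots> \<le> (\<Sum>e\<in>?P. count (edges H) e)" by (rule sum_mono) auto
    also have "\<dots> = count ?M g" unfolding edges_link count_image_mset ..
    finally show ?thesis using inj_on_finite[OF inj sub] by simp
  qed
  have "\<exists>c. c ` {..<count ?M g} = W g" if g: "g \<in># ?M" for g
  proof -
    obtain b where b: "bij_betw b {..<card (W g)} (W g)"
      using ex_bij_betw_nat_finite[of "W g"] W[OF g] by (auto simp: atLeast0LessThan)
    obtain e where "e \<in># edges H" "g = e - A" using g unfolding edges_link by auto
    then have "W g \<noteq> {}" using dec by blast
    then have pos: "0 < card (W g)" using W[OF g] by (simp add: card_gt_0_iff)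
    let ?c = "\<lambda>k. b (if k < card (W g) then k else 0)"
    have "?c ` {..<count ?M g} \<subseteq> W g" using b pos by (auto simp: bij_betw_def)
    moreover have "W g \<subseteq> ?c ` {..<count ?M g}"
    proof
      fix v assume "v \<in> W g"
      then obtain k where k: "k < card (W g)" "v = b k" using b by (auto simp: bij_betw_def)
      then have "k < count ?M g" using W[OF g] by linarith
      then show "v \<in> ?c ` {..<count ?M g}" using k by (intro image_eqI[of _ _ k]) auto
    qed
    ultimately show ?thesis by (intro exI[of _ ?c]) blast
  qed
  then have "\<forall>g\<in>set_mset ?M. \<exists>c. c ` {..<count ?M g} = W g" by blast
  then have "\<exists>c. \<forall>g\<in>set_mset ?M. c g ` {..<count ?M g} = W g" by (rule bchoice)
  then obtain c where c: "\<And>g. g \<in># ?M \<Longrightarrow> c g ` {..<count ?M g} = W g" by blast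
  show thesis
  proof (rule that[of "\<lambda>x. c (fst x) (snd x)"])
    fix x assume x: "x \<in> edge_copies (link H A A)"
    then have "snd x < count ?M (fst x)" unfolding edge_copies_def by auto
    then have "c (fst x) (snd x) \<in> W (fst x)" using c[OF edge_copiesD[OF x]] by blast
    then show "c (fst x) (snd x) \<in> A \<and> insert (c (fst x) (snd x)) (fst x) \<in># edges H"
      unfolding W_def by simp
  next
    fix e assume e: "e \<in># edges H"
    then obtain v where v: "v \<in> W (e - A)" "e = insert v (e - A)" using dec by blast
    have "e - A \<in># ?M" unfolding edges_link using e by auto
    then have "v \<in> c (e - A) ` {..<count ?M (e - A)}" using c v(1) by simp
    then obtain k where "k < count ?M (e - A)" "c (e - A) k = v" by blast
    then show "\<exists>x\<in>edge_copies (link H A A). fst x = e - A \<and> e = insert (c (fst x) (snd x)) (fst x)"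
      using v(2) by (intro bexI[of _ "(e - A, k)"]) (auto simp: edge_copies_def)
  qed
qed

lemma three_partite_edge:
  assumes "r_graph 3 H" "r_partite 3 V H" "i \<in> {1, 2, 3}"
  obtains L R where "V i \<subseteq> vertices H" "L \<inter> R = {}"
    "\<And>e. e \<in># edges H \<Longrightarrow> card (e \<inter> V i) = 1"
    "\<And>e. e \<in># edges H \<Longrightarrow> \<exists>l\<in>L. \<exists>r\<in>R. e - V i = {l, r}"
proof -
  have set3: "{1..3} = {1, 2, 3::nat}" by auto
  obtain j k where jk: "{1, 2, 3} = {i, j, k}" "i \<noteq> j" "i \<noteq> k" "j \<noteq> k"
  proof -
    consider "i = 1" | "i = 2" | "i = 3" using assms(3) by blast
    then show thesis
    proof cases
      case 1
      then show ?thesis by (intro that[of 2 3]) auto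
    next
      case 2
      then show ?thesis by (intro that[of 1 3]) auto
    next
      case 3
      then show ?thesis by (intro that[of 1 2]) auto
    qed
  qed
  have V: "disjoint_family_on V {i, j, k}" "(\<Union>l\<in>{i, j, k}. V l) = vertices H"
    "\<And>e l. e \<in># edges H \<Longrightarrow> l \<in> {i, j, k} \<Longrightarrow> card (e \<inter> V l) = 1"
    using assms(2) unfolding r_partite_def set3 jk(1) by blast+
  have dis: "V i \<inter> V j = {}" "V i \<inter> V k = {}" "V j \<inter> V k = {}"
    using V(1) jk(2-4) unfolding disjoint_family_on_def by auto
  have "\<exists>l\<in>V j. \<exists>r\<in>V k. e - V i = {l, r}" if e: "e \<in># edges H" for e
  proof -
    obtain l where l: "e \<inter> V j = {l}" using V(3)[OF e, of j] card_1_singletonE by blast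
    obtain r where r: "e \<inter> V k = {r}" using V(3)[OF e, of k] card_1_singletonE by blast
    have "e \<subseteq> vertices H" using assms(1) e unfolding r_graph_def by blast
    then have "e \<subseteq> V i \<union> V j \<union> V k" using V(2) by auto
    then have "e - V i = (e \<inter> V j) \<union> (e \<inter> V k)" using dis by blast
    then have "e - V i = {l, r}" using l r by auto
    moreover have "l \<in> V j" "r \<in> V k" using l r by auto
    ultimately show ?thesis by blast
  qed
  then show thesis using V dis by (intro that[of "V j" "V k"]) auto
qed

text \<open>From each colour class choose one member of the matching. Completing the chosen pairs by their
colours keeps them disjoint, since the colours are distinct and lie outside the pairs.\<close>

lemma rainbow_matching_lifts:
  assumes apex: "\<And>x. x \<in> edge_copies (link H A A) \<Longrightarrow> apex x \<in> A \<and> insert (apex x) (fst x) \<in># edges H"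
    and \<sigma>: "\<sigma> \<in> matching_complex fst (edge_copies (link H A A))"
  shows "card (apex ` \<sigma>) \<le> matching_number H"
proof -
  obtain \<sigma>' where \<sigma>': "\<sigma>' \<subseteq> \<sigma>" "inj_on apex \<sigma>'" "apex ` \<sigma>' = apex ` \<sigma>"
    using subset_image_inj[of "apex ` \<sigma>" apex \<sigma>] by auto
  have sub: "\<sigma>' \<subseteq> edge_copies (link H A A)" and dis: "pairwise (\<lambda>x y. fst x \<inter> fst y = {}) \<sigma>'"
    using \<sigma> \<sigma>'(1) unfolding matching_complex_def disjoint_ends_def by (auto intro: pairwise_subset)
  have avoid: "fst x \<inter> A = {}" if "x \<in> \<sigma>'" for x
  proof -
    have "fst x \<in># edges (link H A A)" using that sub edge_copiesD by blast
    then show ?thesis unfolding edges_link by auto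
  qed
  define lift where "lift x = (insert (apex x) (fst x), 0::nat)" for x
  have lift_dis: "fst (lift x) \<inter> fst (lift y) = {}" if xy: "x \<in> \<sigma>'" "y \<in> \<sigma>'" "x \<noteq> y" for x y
  proof -
    have "fst x \<inter> fst y = {}" using dis xy unfolding pairwise_def by blast
    moreover have "apex x \<noteq> apex y" using \<sigma>'(2) xy unfolding inj_on_def by blast
    moreover have "apex x \<in> A" "apex y \<in> A" using apex sub xy by blast+
    ultimately show ?thesis using avoid[OF xy(1)] avoid[OF xy(2)] unfolding lift_def by auto
  qed
  have inj: "inj_on lift \<sigma>'"
  proof (rule inj_onI, rule ccontr)
    fix x y assume "x \<in> \<sigma>'" "y \<in> \<sigma>'" "lift x = lift y" "x \<noteq> y"
    then show False using lift_dis[of x y] unfolding lift_def by auto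
  qed
  have "matching H (lift ` \<sigma>')" unfolding matching_def
  proof
    show "lift ` \<sigma>' \<subseteq> edge_copies H"
      using apex sub unfolding lift_def edge_copies_def by auto
    show "pairwise (\<lambda>x y. fst x \<inter> fst y = {}) (lift ` \<sigma>')"
      using lift_dis unfolding pairwise_def by blast
  qed
  then have "card (lift ` \<sigma>') \<le> matching_number H" by (rule card_le_matching_number)
  then show ?thesis using card_image[OF inj] card_image[OF \<sigma>'(2)] \<sigma>'(3) by simp
qed

section \<open>Tripartite hypergraphs that are extremal for the covering number\<close>

theorem theorem1p4:
  fixes H :: "'a hypergraph" and V :: "nat \<Rightarrow> 'a set" and i :: nat
  assumes "r_graph 3 H" and "r_partite 3 V H"
    and "cover_number H = 2 * matching_number H"
    and "i \<in> {1, 2, 3}"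
  shows "graph_conn (line_graph (link H (V i) (V i))) = ereal (real (matching_number H) - 2) \<and>
         matching_number (link H (V i) (V i)) = cover_number H \<and>
         graph_conn (line_graph (link H (V i) (V i))) =
           ereal (real (matching_number (link H (V i) (V i))) / 2 - 2)"
proof -
  define A where "A = V i"
  define \<nu> where "\<nu> = matching_number H"
  define E where "E = edge_copies (link H A A)"
  define K where "K = matching_complex fst E"
  obtain L R where AV: "A \<subseteq> vertices H" and LR: "L \<inter> R = {}"
    and HA: "\<And>e. e \<in># edges H \<Longrightarrow> card (e \<inter> A) = 1"
    and HLR: "\<And>e. e \<in># edges H \<Longrightarrow> \<exists>l\<in>L. \<exists>r\<in>R. e - A = {l, r}"
    using three_partite_edge[OF assms(1,2,4)] unfolding A_def by metis
  obtain apex where apex: "\<And>x. x \<in> E \<Longrightarrow> apex x \<in> A \<and> insert (apex x) (fst x) \<in># edges H"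
    and apex_surj: "\<And>e. e \<in># edges H \<Longrightarrow> \<exists>x\<in>E. fst x = e - A \<and> e = insert (apex x) (fst x)"
    unfolding E_def by (rule link_apex[OF HA]) blast+
  have finH: "finite (vertices H)" using assms(1) unfolding r_graph_def by blast
  have finA: "finite A" using finite_subset[OF AV finH] .
  have finE: "finite E" unfolding E_def by (rule finite_edge_copies)
  have ends: "\<exists>l\<in>L. \<exists>r\<in>R. fst x = {l, r}" if x: "x \<in> E" for x
  proof -
    have "fst x \<in># edges (link H A A)" using x unfolding E_def by (rule edge_copiesD)
    then obtain e where "e \<in># edges H" "fst x = e - A" unfolding edges_link by auto
    then show ?thesis using HLR by simp
  qed
  \<comment> \<open>A cover of the link edges whose apex is outside T, together with T, covers H. So
    by the theorem of Koenig these edges contain a matching of size at least 2 * \<nu> - card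
    T.\<close>
  have big: "\<exists>M \<in> matching_complex fst {x \<in> E. apex x \<notin> T}. 2 * \<nu> \<le> card T + card M"
    if T: "T \<subseteq> A" for T
  proof -
    let ?E = "{x \<in> E. apex x \<notin> T}"
    have "\<exists>M C. M \<subseteq> ?E \<and> disjoint_ends fst M \<and> finite C \<and> (\<forall>e\<in>?E. fst e \<inter> C \<noteq> {}) \<and> card C \<le> card M"
      by (rule konig[OF _ _ LR]) (use finE ends in auto)
    then obtain M C where M: "M \<in> matching_complex fst ?E" and C: "finite C" "card C \<le> card M"
      and cov: "\<And>e. e \<in> ?E \<Longrightarrow> fst e \<inter> C \<noteq> {}" unfolding matching_complex_def by blast
    have "vertex_cover H (T \<union> (C \<inter> vertices H))" unfolding vertex_cover_def
    proof (intro conjI ballI)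
      show "T \<union> C \<inter> vertices H \<subseteq> vertices H" using T AV by blast
      fix e assume e: "e \<in># edges H"
      then have eV: "e \<subseteq> vertices H" using assms(1) unfolding r_graph_def by blast
      obtain x where x: "x \<in> E" "fst x = e - A" "e = insert (apex x) (fst x)" using apex_surj[OF e] by blast
      show "e \<inter> (T \<union> C \<inter> vertices H) \<noteq> {}"
      proof (cases "apex x \<in> T")
        case True
        then show ?thesis using x(3) by blast
      next
        case False
        then have "fst x \<inter> C \<noteq> {}" using cov x(1) by blast
        then show ?thesis using x(2) eV by blast
      qed
    qed
    then have "2 * \<nu> \<le> card (T \<union> (C \<inter> vertices H))"
      using cover_number_le[OF finH] assms(3) unfolding \<nu>_def by simp
    also have "\<dots> \<le> card T + card (C \<inter> vertices H)" by (rule card_Un_le)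
    also have "card (C \<inter> vertices H) \<le> card C" using C(1) by (intro card_mono) auto
    finally show ?thesis using C(2) M by (intro bexI[of _ M]) auto
  qed
  have fst2: "finite (fst x) \<and> card (fst x) \<le> 2" if "x \<in> E" for x
    using ends[OF that] by (auto simp: card_insert_if)
  have conn_sub: "fills j (realization (matching_complex fst {x \<in> E. apex x \<notin> T}))"
    if T: "T \<subseteq> A" and j: "2 * j + 1 + card T \<le> 2 * \<nu>" for T j
  proof -
    obtain M where M: "M \<in> matching_complex fst {x \<in> E. apex x \<notin> T}" "2 * \<nu> \<le> card T + card M"
      using big[OF T] by blast
    show ?thesis by (rule fills_matching_complex[OF _ _ M(1)]) (use finE fst2 M(2) j in auto)
  qed
  have lower: "fills j (realization K)" if "j < \<nu>" for j
    using conn_sub[of "{}" j] that unfolding K_def by simp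
  \<comment> \<open>If the complex were one degree more connected, the topological Hall theorem would
    give \<nu> + 1 disjoint edges of H. The extra degree is what the case T = {} needs; for t = card
    T \<ge> 1 the bound 2 * (\<nu> - t) + 1 \<le> 2 * \<nu> - t holds by the size of the matchings
    alone.\<close>
  have upper: "\<not> fills \<nu> (realization K)"
  proof
    assume top: "fills \<nu> (realization K)"
    obtain idx where idx: "bij_betw idx A {..<card A}"
      using ex_bij_betw_finite_nat[OF finA] by (auto simp: atLeast0LessThan)
    obtain \<sigma> where \<sigma>: "\<sigma> \<in> K" "Suc \<nu> \<le> card ((idx \<circ> apex) ` \<sigma>)"
    proof (rule rainbow_simplex[of E K "idx \<circ> apex" "card A" "Suc \<nu>"])
      show "simplicial_complex E K" unfolding K_def by (rule simplicial_matching_complex[OF finE])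
      show "(idx \<circ> apex) e < card A" if "e \<in> E" for e
        using apex[OF that] idx unfolding bij_betw_def by auto
      fix T j assume T: "T \<subseteq> {..<card A}" "card T + j < Suc \<nu>"
      show "fills j (realization {\<sigma> \<in> K. \<forall>e\<in>\<sigma>. (idx \<circ> apex) e \<notin> T})"
      proof (cases "T = {}")
        case True
        then show ?thesis using T(2) lower top by (cases "j = \<nu>") auto
      next
        case False
        let ?T = "{v \<in> A. idx v \<in> T}"
        have imT: "idx ` ?T = T" using T(1) unfolding bij_betw_imp_surj_on[OF idx, symmetric] by blast
        moreover have "inj_on idx ?T" by (rule inj_on_subset[OF bij_betw_imp_inj_on[OF idx]]) blast
        ultimately have cT: "card ?T = card T" by (metis card_image)
        have "0 < card T" using False T(1) finite_subset by (auto simp: card_gt_0_iff)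
        have "{\<sigma> \<in> K. \<forall>e\<in>\<sigma>. (idx \<circ> apex) e \<notin> T} = matching_complex fst {x \<in> E. apex x \<notin> ?T}"
          using apex unfolding K_def matching_complex_def by auto
        moreover have "fills j (realization (matching_complex fst {x \<in> E. apex x \<notin> ?T}))"
          by (rule conn_sub) (use T(2) cT \<open>0 < card T\<close> in auto)
        ultimately show ?thesis by simp
      qed
    qed auto
    have "finite \<sigma>" using \<sigma>(1) finE finite_subset unfolding K_def matching_complex_def by blast
    then have "card ((idx \<circ> apex) ` \<sigma>) \<le> card (apex ` \<sigma>)"
      unfolding image_comp[symmetric] by (intro card_image_le) auto
    also have "\<dots> \<le> \<nu>"
      unfolding \<nu>_def by (rule rainbow_matching_lifts[of H A]) (use apex \<sigma>(1) in \<open>auto simp: E_def K_def\<close>)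
    finally show False using \<sigma>(2) by simp
  qed
  have conn: "graph_conn (line_graph (link H A A)) = ereal (real \<nu> - 2)"
    unfolding graph_conn_line_graph using conn_eq_fills[of \<nu> "realization K"] lower upper
    unfolding K_def E_def by blast
  have match: "matching_number (link H A A) = 2 * \<nu>"
  proof (rule antisym)
    obtain M where M: "M \<in> K" "2 * \<nu> \<le> card M" using big[of "{}"] unfolding K_def by auto
    then show "2 * \<nu> \<le> matching_number (link H A A)"
      using card_le_matching_number[of "link H A A" M] unfolding matching_iff K_def E_def by simp
    obtain N where N: "N \<in> K" "card N = matching_number (link H A A)"
      using matching_number_attained[of "link H A A"] unfolding matching_iff K_def E_def by blast
    show "matching_number (link H A A) \<le> 2 * \<nu>"
    proof (rule ccontr)
      assume "\<not> matching_number (link H A A) \<le> 2 * \<nu>"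
      then have "2 * \<nu> + 1 \<le> card N" using N(2) by simp
      then have "fills \<nu> (realization K)"
        using fills_matching_complex[OF finE, of fst N \<nu>] fst2 N(1) unfolding K_def by blast
      then show False using upper by contradiction
    qed
  qed
  show ?thesis using conn match assms(3) unfolding A_def \<nu>_def by simp
qed

end
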